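(* Let $\mathcal{C}$ be a nilpotent modular category of nilpotency class $c$. Then for each $n\ge\frac{c}{2}$ the fusion subcategory $\mathcal{C}^{(n)}\subseteq\mathcal{C}$ is symmetric.
   Context: $k$ is an algebraically closed field of characteristic $0$. A fusion category is a $k$-linear semisimple rigid tensor category with finitely many isomorphism classes of simple objects, finite-dimensional morphism spaces, and simple unit object; a fusion subcategory is a full tensor subcategory. A modular category is a ribbon fusion category with non-degenerate $S$-matrix. A braided fusion category is symmetric if the double braiding $X\otimes Y\to Y\otimes X\to X\otimes Y$ is the identity for all objects $X,Y$. For a fusion category $\mathcal{D}$, $\mathcal{D}_{ad}$ is the full tensor subcategory generated by all subobjects of $X\otimes X^*$, $X$ simple in $\mathcal{D}$. Upper central series: $\mathcal{C}^{(0)}=\mathcal{C}$, $\mathcal{C}^{(n)}=(\mathcal{C}^{(n-1)})_{ad}$ for integers $n\ge1$. $\mathcal{C}$ is nilpotent if $\mathcal{C}^{(n)}=\mathrm{Vec}$ (the fusion subcategory generated by the unit object) for some $n$; the smallest such $n$ is the nilpotency class of $\mathcal{C}$. *)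

theory Defs
  imports "Jordan_Normal_Form.Determinant"
begin

section \<open>Linear categories\<close>

text \<open>
  A small \<open>k\<close>-linear category is given by a set of objects and, for any two objects, a linear
  subspace \<open>Hom C X Y\<close> of one ambient \<open>k\<close>-vector space of arrows. This is no restriction: for the
  ambient space one may take the direct sum of all spaces of morphisms, with composition (and
  the tensor product of morphisms) extended bilinearly. The spaces \<open>Hom C X Y\<close> are not
  required to be independent, so source and target of an arrow are always mentioned
  explicitly. Nothing is assumed about the operations outside of the objects and the spaces of
  morphisms between them, so that a full subcategory is obtained by just replacing \<open>Obj\<close>.

  \<open>g \<cdot> f\<close> is the composite ``\<open>g\<close> after \<open>f\<close>''.
\<close>

record ('o, 'm, 'k) category_data =
  Obj :: "'o set"
  Hom :: "'o \<Rightarrow> 'o \<Rightarrow> 'm set"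
  Id :: "'o \<Rightarrow> 'm"
  Comp :: "'m \<Rightarrow> 'm \<Rightarrow> 'm"  (infixr \<open>\<cdot>\<index>\<close> 70)
  Scale :: "'k \<Rightarrow> 'm \<Rightarrow> 'm"

locale linear_category = vector_space "Scale C"
  for C :: "('o, 'm::ab_group_add, 'k::field, 'z) category_data_scheme" (structure) +
  assumes Hom_subspace: "\<lbrakk>X \<in> Obj C; Y \<in> Obj C\<rbrakk> \<Longrightarrow> subspace (Hom C X Y)"
    and Id_in_Hom: "X \<in> Obj C \<Longrightarrow> Id C X \<in> Hom C X X"
    and Comp_in_Hom:
      "\<lbrakk>X \<in> Obj C; Y \<in> Obj C; Z \<in> Obj C; f \<in> Hom C X Y; g \<in> Hom C Y Z\<rbrakk>
        \<Longrightarrow> g \<cdot> f \<in> Hom C X Z"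
    and Comp_Id: "\<lbrakk>X \<in> Obj C; Y \<in> Obj C; f \<in> Hom C X Y\<rbrakk> \<Longrightarrow> f \<cdot> Id C X = f"
    and Id_Comp: "\<lbrakk>X \<in> Obj C; Y \<in> Obj C; f \<in> Hom C X Y\<rbrakk> \<Longrightarrow> Id C Y \<cdot> f = f"
    and Comp_assoc:
      "\<lbrakk>W \<in> Obj C; X \<in> Obj C; Y \<in> Obj C; Z \<in> Obj C;
        f \<in> Hom C W X; g \<in> Hom C X Y; h \<in> Hom C Y Z\<rbrakk>
        \<Longrightarrow> (h \<cdot> g) \<cdot> f = h \<cdot> (g \<cdot> f)"
    and Comp_add_left:
      "\<lbrakk>X \<in> Obj C; Y \<in> Obj C; Z \<in> Obj C; f \<in> Hom C X Y; g \<in> Hom C Y Z; h \<in> Hom C Y Z\<rbrakk>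
        \<Longrightarrow> (g + h) \<cdot> f = g \<cdot> f + h \<cdot> f"
    and Comp_add_right:
      "\<lbrakk>X \<in> Obj C; Y \<in> Obj C; Z \<in> Obj C; f \<in> Hom C X Y; h \<in> Hom C X Y; g \<in> Hom C Y Z\<rbrakk>
        \<Longrightarrow> g \<cdot> (f + h) = g \<cdot> f + g \<cdot> h"
    and Comp_scale_left:
      "\<lbrakk>X \<in> Obj C; Y \<in> Obj C; Z \<in> Obj C; f \<in> Hom C X Y; g \<in> Hom C Y Z\<rbrakk>
        \<Longrightarrow> Scale C a g \<cdot> f = Scale C a (g \<cdot> f)"
    and Comp_scale_right:
      "\<lbrakk>X \<in> Obj C; Y \<in> Obj C; Z \<in> Obj C; f \<in> Hom C X Y; g \<in> Hom C Y Z\<rbrakk>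
        \<Longrightarrow> g \<cdot> Scale C a f = Scale C a (g \<cdot> f)"

definition mutually_inverse where
  "mutually_inverse C X Y f g \<longleftrightarrow>
    f \<in> Hom C X Y \<and> g \<in> Hom C Y X \<and> g \<cdot>\<^bsub>C\<^esub> f = Id C X \<and> f \<cdot>\<^bsub>C\<^esub> g = Id C Y"

definition iso_arrow where
  "iso_arrow C X Y f \<longleftrightarrow> (\<exists>g. mutually_inverse C X Y f g)"

definition inv_arrow where
  "inv_arrow C X Y f = (THE g. mutually_inverse C X Y f g)"

definition isomorphic_obj where
  "isomorphic_obj C X Y \<longleftrightarrow> (\<exists>f. iso_arrow C X Y f)"

definition mono_arrow where
  "mono_arrow C X Y f \<longleftrightarrow> f \<in> Hom C X Y \<and>
    (\<forall>W\<in>Obj C. \<forall>g\<in>Hom C W X. \<forall>h\<in>Hom C W X. f \<cdot>\<^bsub>C\<^esub> g = f \<cdot>\<^bsub>C\<^esub> h \<longrightarrow> g = h)"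

definition epi_arrow where
  "epi_arrow C X Y f \<longleftrightarrow> f \<in> Hom C X Y \<and>
    (\<forall>W\<in>Obj C. \<forall>g\<in>Hom C Y W. \<forall>h\<in>Hom C Y W. g \<cdot>\<^bsub>C\<^esub> f = h \<cdot>\<^bsub>C\<^esub> f \<longrightarrow> g = h)"

definition subobject where
  "subobject C Y X \<longleftrightarrow> (\<exists>f. mono_arrow C Y X f)"

definition zero_object where
  "zero_object C Z \<longleftrightarrow> Z \<in> Obj C \<and> (\<forall>X\<in>Obj C. Hom C Z X = {0} \<and> Hom C X Z = {0})"

definition is_kernel where
  "is_kernel C X Y f K i \<longleftrightarrow> i \<in> Hom C K X \<and> f \<cdot>\<^bsub>C\<^esub> i = 0 \<and>
    (\<forall>W\<in>Obj C. \<forall>h\<in>Hom C W X. f \<cdot>\<^bsub>C\<^esub> h = 0 \<longrightarrow> (\<exists>!u. u \<in> Hom C W K \<and> i \<cdot>\<^bsub>C\<^esub> u = h))"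

definition is_cokernel where
  "is_cokernel C X Y f Q p \<longleftrightarrow> p \<in> Hom C Y Q \<and> p \<cdot>\<^bsub>C\<^esub> f = 0 \<and>
    (\<forall>W\<in>Obj C. \<forall>h\<in>Hom C Y W. h \<cdot>\<^bsub>C\<^esub> f = 0 \<longrightarrow> (\<exists>!u. u \<in> Hom C Q W \<and> u \<cdot>\<^bsub>C\<^esub> p = h))"

text \<open>
  \<open>P\<close> is a direct sum (biproduct) of the objects in the list \<open>Xs\<close>. For \<open>Xs = []\<close> this says that
  \<open>P\<close> is a zero object, for \<open>Xs = [X]\<close> that \<open>P\<close> is isomorphic to \<open>X\<close>.
\<close>

definition is_direct_sum where
  "is_direct_sum C Xs P \<longleftrightarrow> (\<exists>\<iota> \<pi>.
    (\<forall>i<length Xs. \<iota> i \<in> Hom C (Xs ! i) P \<and> \<pi> i \<in> Hom C P (Xs ! i)) \<and>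
    (\<forall>i<length Xs. \<forall>j<length Xs. \<pi> i \<cdot>\<^bsub>C\<^esub> \<iota> j = (if i = j then Id C (Xs ! i) else 0)) \<and>
    (\<Sum>i<length Xs. \<iota> i \<cdot>\<^bsub>C\<^esub> \<pi> i) = Id C P)"

definition simple_object where
  "simple_object C X \<longleftrightarrow> X \<in> Obj C \<and> \<not> zero_object C X \<and>
    (\<forall>Y\<in>Obj C. \<forall>f. mono_arrow C Y X f \<longrightarrow> zero_object C Y \<or> iso_arrow C Y X f)"

definition simple_representatives where
  "simple_representatives C Xs \<longleftrightarrow> (\<forall>X\<in>set Xs. simple_object C X) \<and>
    (\<forall>i<length Xs. \<forall>j<length Xs. isomorphic_obj C (Xs ! i) (Xs ! j) \<longrightarrow> i = j) \<and>
    (\<forall>X. simple_object C X \<longrightarrow> (\<exists>Y\<in>set Xs. isomorphic_obj C X Y))"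

locale abelian_category = linear_category +
  assumes direct_sum_exists: "set Xs \<subseteq> Obj C \<Longrightarrow> \<exists>P\<in>Obj C. is_direct_sum C Xs P"
    and kernel_exists:
      "\<lbrakk>X \<in> Obj C; Y \<in> Obj C; f \<in> Hom C X Y\<rbrakk> \<Longrightarrow> \<exists>K\<in>Obj C. \<exists>i. is_kernel C X Y f K i"
    and cokernel_exists:
      "\<lbrakk>X \<in> Obj C; Y \<in> Obj C; f \<in> Hom C X Y\<rbrakk> \<Longrightarrow> \<exists>Q\<in>Obj C. \<exists>p. is_cokernel C X Y f Q p"
    and mono_is_kernel:
      "\<lbrakk>X \<in> Obj C; Y \<in> Obj C; mono_arrow C X Y f\<rbrakk>
        \<Longrightarrow> \<exists>Z\<in>Obj C. \<exists>g\<in>Hom C Y Z. is_kernel C Y Z g X f"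
    and epi_is_cokernel:
      "\<lbrakk>X \<in> Obj C; Y \<in> Obj C; epi_arrow C X Y f\<rbrakk>
        \<Longrightarrow> \<exists>Z\<in>Obj C. \<exists>g\<in>Hom C Z X. is_cokernel C Z X g Y f"

locale semisimple_category = abelian_category +
  assumes semisimple:
    "X \<in> Obj C \<Longrightarrow> \<exists>Ys. (\<forall>Y\<in>set Ys. simple_object C Y) \<and> is_direct_sum C Ys X"


section \<open>Rigid tensor categories\<close>

text \<open>
  \<open>Assoc C X Y Z : (X \<otimes> Y) \<otimes> Z \<rightarrow> X \<otimes> (Y \<otimes> Z)\<close>, \<open>LUnit C X : 1 \<otimes> X \<rightarrow> X\<close>,
  \<open>RUnit C X : X \<otimes> 1 \<rightarrow> X\<close>.
\<close>

record ('o, 'm, 'k) monoidal_data = "('o, 'm, 'k) category_data" +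
  Unit :: 'o
  TObj :: "'o \<Rightarrow> 'o \<Rightarrow> 'o"  (infixr \<open>\<otimes>\<^sub>o\<index>\<close> 75)
  TArr :: "'m \<Rightarrow> 'm \<Rightarrow> 'm"  (infixr \<open>\<otimes>\<^sub>a\<index>\<close> 75)
  Assoc :: "'o \<Rightarrow> 'o \<Rightarrow> 'o \<Rightarrow> 'm"
  LUnit :: "'o \<Rightarrow> 'm"
  RUnit :: "'o \<Rightarrow> 'm"

locale tensor_category = linear_category C
  for C :: "('o, 'm::ab_group_add, 'k::field, 'z) monoidal_data_scheme" (structure) +
  assumes Unit_in_Obj: "Unit C \<in> Obj C"
    and TObj_in_Obj: "\<lbrakk>X \<in> Obj C; Y \<in> Obj C\<rbrakk> \<Longrightarrow> X \<otimes>\<^sub>o Y \<in> Obj C"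
    and TArr_in_Hom:
      "\<lbrakk>X \<in> Obj C; X' \<in> Obj C; Y \<in> Obj C; Y' \<in> Obj C; f \<in> Hom C X X'; g \<in> Hom C Y Y'\<rbrakk>
        \<Longrightarrow> f \<otimes>\<^sub>a g \<in> Hom C (X \<otimes>\<^sub>o Y) (X' \<otimes>\<^sub>o Y')"
    and TArr_Id: "\<lbrakk>X \<in> Obj C; Y \<in> Obj C\<rbrakk> \<Longrightarrow> Id C X \<otimes>\<^sub>a Id C Y = Id C (X \<otimes>\<^sub>o Y)"
    and TArr_Comp:
      "\<lbrakk>X \<in> Obj C; X' \<in> Obj C; X'' \<in> Obj C; Y \<in> Obj C; Y' \<in> Obj C; Y'' \<in> Obj C;
        f \<in> Hom C X X'; f' \<in> Hom C X' X''; g \<in> Hom C Y Y'; g' \<in> Hom C Y' Y''\<rbrakk>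
        \<Longrightarrow> (f' \<cdot> f) \<otimes>\<^sub>a (g' \<cdot> g) = (f' \<otimes>\<^sub>a g') \<cdot> (f \<otimes>\<^sub>a g)"
    and TArr_add_left:
      "\<lbrakk>X \<in> Obj C; X' \<in> Obj C; Y \<in> Obj C; Y' \<in> Obj C;
        f \<in> Hom C X X'; h \<in> Hom C X X'; g \<in> Hom C Y Y'\<rbrakk>
        \<Longrightarrow> (f + h) \<otimes>\<^sub>a g = (f \<otimes>\<^sub>a g) + (h \<otimes>\<^sub>a g)"
    and TArr_add_right:
      "\<lbrakk>X \<in> Obj C; X' \<in> Obj C; Y \<in> Obj C; Y' \<in> Obj C;
        f \<in> Hom C X X'; g \<in> Hom C Y Y'; h \<in> Hom C Y Y'\<rbrakk>
        \<Longrightarrow> f \<otimes>\<^sub>a (g + h) = (f \<otimes>\<^sub>a g) + (f \<otimes>\<^sub>a h)"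
    and TArr_scale_left:
      "\<lbrakk>X \<in> Obj C; X' \<in> Obj C; Y \<in> Obj C; Y' \<in> Obj C; f \<in> Hom C X X'; g \<in> Hom C Y Y'\<rbrakk>
        \<Longrightarrow> Scale C a f \<otimes>\<^sub>a g = Scale C a (f \<otimes>\<^sub>a g)"
    and TArr_scale_right:
      "\<lbrakk>X \<in> Obj C; X' \<in> Obj C; Y \<in> Obj C; Y' \<in> Obj C; f \<in> Hom C X X'; g \<in> Hom C Y Y'\<rbrakk>
        \<Longrightarrow> f \<otimes>\<^sub>a Scale C a g = Scale C a (f \<otimes>\<^sub>a g)"
    and Assoc_iso:
      "\<lbrakk>X \<in> Obj C; Y \<in> Obj C; Z \<in> Obj C\<rbrakk>
        \<Longrightarrow> iso_arrow C ((X \<otimes>\<^sub>o Y) \<otimes>\<^sub>o Z) (X \<otimes>\<^sub>o (Y \<otimes>\<^sub>o Z)) (Assoc C X Y Z)"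
    and Assoc_natural:
      "\<lbrakk>X \<in> Obj C; X' \<in> Obj C; Y \<in> Obj C; Y' \<in> Obj C; Z \<in> Obj C; Z' \<in> Obj C;
        f \<in> Hom C X X'; g \<in> Hom C Y Y'; h \<in> Hom C Z Z'\<rbrakk>
        \<Longrightarrow> Assoc C X' Y' Z' \<cdot> ((f \<otimes>\<^sub>a g) \<otimes>\<^sub>a h) = (f \<otimes>\<^sub>a (g \<otimes>\<^sub>a h)) \<cdot> Assoc C X Y Z"
    and LUnit_iso: "X \<in> Obj C \<Longrightarrow> iso_arrow C (Unit C \<otimes>\<^sub>o X) X (LUnit C X)"
    and LUnit_natural:
      "\<lbrakk>X \<in> Obj C; X' \<in> Obj C; f \<in> Hom C X X'\<rbrakk>
        \<Longrightarrow> LUnit C X' \<cdot> (Id C (Unit C) \<otimes>\<^sub>a f) = f \<cdot> LUnit C X"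
    and RUnit_iso: "X \<in> Obj C \<Longrightarrow> iso_arrow C (X \<otimes>\<^sub>o Unit C) X (RUnit C X)"
    and RUnit_natural:
      "\<lbrakk>X \<in> Obj C; X' \<in> Obj C; f \<in> Hom C X X'\<rbrakk>
        \<Longrightarrow> RUnit C X' \<cdot> (f \<otimes>\<^sub>a Id C (Unit C)) = f \<cdot> RUnit C X"
    and pentagon:
      "\<lbrakk>W \<in> Obj C; X \<in> Obj C; Y \<in> Obj C; Z \<in> Obj C\<rbrakk>
        \<Longrightarrow> Assoc C W X (Y \<otimes>\<^sub>o Z) \<cdot> Assoc C (W \<otimes>\<^sub>o X) Y Z
          = (Id C W \<otimes>\<^sub>a Assoc C X Y Z) \<cdot> Assoc C W (X \<otimes>\<^sub>o Y) Z \<cdot> (Assoc C W X Y \<otimes>\<^sub>a Id C Z)"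
    and triangle:
      "\<lbrakk>X \<in> Obj C; Y \<in> Obj C\<rbrakk>
        \<Longrightarrow> (Id C X \<otimes>\<^sub>a LUnit C Y) \<cdot> Assoc C X (Unit C) Y = RUnit C X \<otimes>\<^sub>a Id C Y"

text \<open>
  \<open>Y\<close> is a left dual of \<open>X\<close> (and \<open>X\<close> a right dual of \<open>Y\<close>) via \<open>e : Y \<otimes> X \<rightarrow> 1\<close> and
  \<open>c : 1 \<rightarrow> X \<otimes> Y\<close>; the two equations are the zigzag identities.
\<close>

definition is_duality where
  "is_duality C X Y e c \<longleftrightarrow>
    e \<in> Hom C (Y \<otimes>\<^sub>o\<^bsub>C\<^esub> X) (Unit C) \<and> c \<in> Hom C (Unit C) (X \<otimes>\<^sub>o\<^bsub>C\<^esub> Y) \<and>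
    RUnit C X \<cdot>\<^bsub>C\<^esub> (Id C X \<otimes>\<^sub>a\<^bsub>C\<^esub> e) \<cdot>\<^bsub>C\<^esub> Assoc C X Y X \<cdot>\<^bsub>C\<^esub> (c \<otimes>\<^sub>a\<^bsub>C\<^esub> Id C X) = LUnit C X \<and>
    LUnit C Y \<cdot>\<^bsub>C\<^esub> (e \<otimes>\<^sub>a\<^bsub>C\<^esub> Id C Y)
      \<cdot>\<^bsub>C\<^esub> inv_arrow C ((Y \<otimes>\<^sub>o\<^bsub>C\<^esub> X) \<otimes>\<^sub>o\<^bsub>C\<^esub> Y) (Y \<otimes>\<^sub>o\<^bsub>C\<^esub> (X \<otimes>\<^sub>o\<^bsub>C\<^esub> Y)) (Assoc C Y X Y)
      \<cdot>\<^bsub>C\<^esub> (Id C Y \<otimes>\<^sub>a\<^bsub>C\<^esub> c) = RUnit C Y"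

text \<open>
  A chosen left dual \<open>X\<^sup>*\<close> with \<open>Ev C X : X\<^sup>* \<otimes> X \<rightarrow> 1\<close> and \<open>Coev C X : 1 \<rightarrow> X \<otimes> X\<^sup>*\<close> is part
  of the data.
\<close>

record ('o, 'm, 'k) rigid_data = "('o, 'm, 'k) monoidal_data" +
  Dual :: "'o \<Rightarrow> 'o"
  Ev :: "'o \<Rightarrow> 'm"
  Coev :: "'o \<Rightarrow> 'm"

locale rigid_category = tensor_category C
  for C :: "('o, 'm::ab_group_add, 'k::field, 'z) rigid_data_scheme" (structure) +
  assumes Dual_in_Obj: "X \<in> Obj C \<Longrightarrow> Dual C X \<in> Obj C"
    and Dual_is_left_dual: "X \<in> Obj C \<Longrightarrow> is_duality C X (Dual C X) (Ev C X) (Coev C X)"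
    and right_dual_exists: "X \<in> Obj C \<Longrightarrow> \<exists>Y\<in>Obj C. \<exists>e c. is_duality C Y X e c"

text \<open>The transpose \<open>f\<^sup>* : Y\<^sup>* \<rightarrow> X\<^sup>*\<close> of \<open>f : X \<rightarrow> Y\<close>.\<close>

definition transpose_arrow where
  "transpose_arrow C X Y f =
    (let X' = Dual C X; Y' = Dual C Y in
      LUnit C X' \<cdot>\<^bsub>C\<^esub> (Ev C Y \<otimes>\<^sub>a\<^bsub>C\<^esub> Id C X') \<cdot>\<^bsub>C\<^esub> ((Id C Y' \<otimes>\<^sub>a\<^bsub>C\<^esub> f) \<otimes>\<^sub>a\<^bsub>C\<^esub> Id C X')
      \<cdot>\<^bsub>C\<^esub> inv_arrow C ((Y' \<otimes>\<^sub>o\<^bsub>C\<^esub> X) \<otimes>\<^sub>o\<^bsub>C\<^esub> X') (Y' \<otimes>\<^sub>o\<^bsub>C\<^esub> (X \<otimes>\<^sub>o\<^bsub>C\<^esub> X')) (Assoc C Y' X X')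
      \<cdot>\<^bsub>C\<^esub> (Id C Y' \<otimes>\<^sub>a\<^bsub>C\<^esub> Coev C X)
      \<cdot>\<^bsub>C\<^esub> inv_arrow C (Y' \<otimes>\<^sub>o\<^bsub>C\<^esub> Unit C) Y' (RUnit C Y'))"


section \<open>Fusion categories and modular categories\<close>

locale fusion_category = rigid_category C + semisimple_category C
  for C :: "('o, 'm::ab_group_add, 'k::{alg_closed_field, field_char_0}, 'z) rigid_data_scheme"
    (structure) +
  assumes Hom_finite_dimensional:
      "\<lbrakk>X \<in> Obj C; Y \<in> Obj C\<rbrakk> \<Longrightarrow> \<exists>B. finite B \<and> span B = Hom C X Y"
    and finitely_many_simples: "\<exists>Xs. simple_representatives C Xs"
    and Unit_simple: "simple_object C (Unit C)"

text \<open>\<open>Braid C X Y : X \<otimes> Y \<rightarrow> Y \<otimes> X\<close> is the braiding and \<open>Twist C X : X \<rightarrow> X\<close> the ribbon twist.\<close>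

record ('o, 'm, 'k) braided_data = "('o, 'm, 'k) rigid_data" +
  Braid :: "'o \<Rightarrow> 'o \<Rightarrow> 'm"

record ('o, 'm, 'k) ribbon_data = "('o, 'm, 'k) braided_data" +
  Twist :: "'o \<Rightarrow> 'm"

locale braided_fusion_category = fusion_category C
  for C :: "('o, 'm::ab_group_add, 'k::{alg_closed_field, field_char_0}, 'z) braided_data_scheme"
    (structure) +
  assumes Braid_iso:
      "\<lbrakk>X \<in> Obj C; Y \<in> Obj C\<rbrakk> \<Longrightarrow> iso_arrow C (X \<otimes>\<^sub>o Y) (Y \<otimes>\<^sub>o X) (Braid C X Y)"
    and Braid_natural:
      "\<lbrakk>X \<in> Obj C; X' \<in> Obj C; Y \<in> Obj C; Y' \<in> Obj C; f \<in> Hom C X X'; g \<in> Hom C Y Y'\<rbrakk>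
        \<Longrightarrow> Braid C X' Y' \<cdot> (f \<otimes>\<^sub>a g) = (g \<otimes>\<^sub>a f) \<cdot> Braid C X Y"
    and hexagon:
      "\<lbrakk>X \<in> Obj C; Y \<in> Obj C; Z \<in> Obj C\<rbrakk>
        \<Longrightarrow> Assoc C Y Z X \<cdot> Braid C X (Y \<otimes>\<^sub>o Z) \<cdot> Assoc C X Y Z
          = (Id C Y \<otimes>\<^sub>a Braid C X Z) \<cdot> Assoc C Y X Z \<cdot> (Braid C X Y \<otimes>\<^sub>a Id C Z)"
    and hexagon':
      "\<lbrakk>X \<in> Obj C; Y \<in> Obj C; Z \<in> Obj C\<rbrakk>
        \<Longrightarrow> inv_arrow C ((Z \<otimes>\<^sub>o X) \<otimes>\<^sub>o Y) (Z \<otimes>\<^sub>o (X \<otimes>\<^sub>o Y)) (Assoc C Z X Y)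
            \<cdot> Braid C (X \<otimes>\<^sub>o Y) Z
            \<cdot> inv_arrow C ((X \<otimes>\<^sub>o Y) \<otimes>\<^sub>o Z) (X \<otimes>\<^sub>o (Y \<otimes>\<^sub>o Z)) (Assoc C X Y Z)
          = (Braid C X Z \<otimes>\<^sub>a Id C Y)
            \<cdot> inv_arrow C ((X \<otimes>\<^sub>o Z) \<otimes>\<^sub>o Y) (X \<otimes>\<^sub>o (Z \<otimes>\<^sub>o Y)) (Assoc C X Z Y)
            \<cdot> (Id C X \<otimes>\<^sub>a Braid C Y Z)"

definition double_braiding where
  "double_braiding C X Y = Braid C Y X \<cdot>\<^bsub>C\<^esub> Braid C X Y"

definition symmetric_braiding where
  "symmetric_braiding C \<longleftrightarrow>
    (\<forall>X\<in>Obj C. \<forall>Y\<in>Obj C. double_braiding C X Y = Id C (X \<otimes>\<^sub>o\<^bsub>C\<^esub> Y))"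

locale ribbon_fusion_category = braided_fusion_category C
  for C :: "('o, 'm::ab_group_add, 'k::{alg_closed_field, field_char_0}, 'z) ribbon_data_scheme"
    (structure) +
  assumes Twist_iso: "X \<in> Obj C \<Longrightarrow> iso_arrow C X X (Twist C X)"
    and Twist_natural:
      "\<lbrakk>X \<in> Obj C; Y \<in> Obj C; f \<in> Hom C X Y\<rbrakk> \<Longrightarrow> Twist C Y \<cdot> f = f \<cdot> Twist C X"
    and Twist_TObj:
      "\<lbrakk>X \<in> Obj C; Y \<in> Obj C\<rbrakk>
        \<Longrightarrow> Twist C (X \<otimes>\<^sub>o Y) = (Twist C X \<otimes>\<^sub>a Twist C Y) \<cdot> double_braiding C X Y"
    and Twist_Dual: "X \<in> Obj C \<Longrightarrow> Twist C (Dual C X) = transpose_arrow C X X (Twist C X)"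

text \<open>
  The quantum trace of an endomorphism \<open>f\<close> of \<open>X\<close> is the composite
  \<open>1 \<rightarrow> X \<otimes> X\<^sup>* \<rightarrow> X \<otimes> X\<^sup>* \<rightarrow> X\<^sup>* \<otimes> X \<rightarrow> 1\<close> of the coevaluation, \<open>(\<theta>\<^sub>X f) \<otimes> id\<close>, the braiding, and
  the evaluation, read as a scalar via \<open>End(1) = k\<close>.
\<close>

definition unit_scalar where
  "unit_scalar C f = (THE a. f = Scale C a (Id C (Unit C)))"

definition qtrace where
  "qtrace C X f = unit_scalar C
    (Ev C X \<cdot>\<^bsub>C\<^esub> Braid C X (Dual C X)
      \<cdot>\<^bsub>C\<^esub> ((Twist C X \<cdot>\<^bsub>C\<^esub> f) \<otimes>\<^sub>a\<^bsub>C\<^esub> Id C (Dual C X)) \<cdot>\<^bsub>C\<^esub> Coev C X)"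

definition S_matrix where
  "S_matrix C Xs = mat (length Xs) (length Xs)
    (\<lambda>(i, j). qtrace C (Xs ! i \<otimes>\<^sub>o\<^bsub>C\<^esub> Xs ! j) (double_braiding C (Xs ! i) (Xs ! j)))"

text \<open>
  The entries of the \<open>S\<close>-matrix only depend on isomorphism classes, so another list of
  representatives of the simple objects just permutes rows and columns simultaneously.
\<close>

locale modular_category = ribbon_fusion_category +
  assumes S_matrix_nondegenerate: "\<exists>Xs. simple_representatives C Xs \<and> det (S_matrix C Xs) \<noteq> 0"


section \<open>Fusion subcategories and the upper central series\<close>

text \<open>
  Fusion subcategories are full and replete, hence given by their objects: they contain the
  unit object and are closed under tensor products, duals, direct sums (in particular
  isomorphic objects) and subobjects.
\<close>

definition is_fusion_subcategory where
  "is_fusion_subcategory C D \<longleftrightarrow> D \<subseteq> Obj C \<and> Unit C \<in> D \<and>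
    (\<forall>X\<in>D. \<forall>Y\<in>D. X \<otimes>\<^sub>o\<^bsub>C\<^esub> Y \<in> D) \<and>
    (\<forall>X\<in>D. Dual C X \<in> D) \<and>
    (\<forall>Xs. \<forall>P\<in>Obj C. set Xs \<subseteq> D \<and> is_direct_sum C Xs P \<longrightarrow> P \<in> D) \<and>
    (\<forall>X\<in>D. \<forall>Y\<in>Obj C. subobject C Y X \<longrightarrow> Y \<in> D)"

definition full_subcategory where
  "full_subcategory C D = C\<lparr>Obj := D\<rparr>"

definition generated_subcategory where
  "generated_subcategory C A =
    full_subcategory C (\<Inter>{D. is_fusion_subcategory C D \<and> A \<subseteq> D})"

definition adjoint_subcategory where
  "adjoint_subcategory C = generated_subcategory C
    {Z \<in> Obj C. \<exists>X. simple_object C X \<and> subobject C Z (X \<otimes>\<^sub>o\<^bsub>C\<^esub> Dual C X)}"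

definition Vec_subcategory where
  "Vec_subcategory C = generated_subcategory C {Unit C}"

definition upper_central where
  "upper_central C n = (adjoint_subcategory ^^ n) C"

definition nilpotent_category where
  "nilpotent_category C \<longleftrightarrow> (\<exists>n. upper_central C n = Vec_subcategory C)"

definition nilpotency_class where
  "nilpotency_class C = (LEAST n. upper_central C n = Vec_subcategory C)"

end

theory Submission
  imports Defs
begin

text \<open>
  Two objects centralize each other if their double braiding is the identity. The theorem follows
  from one fact about simple objects of a braided fusion category (\<open>monodromy_adjoint\<close>): if \<open>X\<close>
  centralizes \<open>Y \<otimes> Y\<^sup>*\<close>, then \<open>Y\<close> centralizes \<open>X \<otimes> X\<^sup>*\<close>.

  To see this, write \<open>M\<close> for the double braiding of \<open>Y\<close> and \<open>X\<close>. The hexagons decompose the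
  double braiding of \<open>X\<close> around \<open>Y \<otimes> Y\<^sup>*\<close> into those around \<open>Y\<close> and around \<open>Y\<^sup>*\<close>. If it is
  trivial, then \<open>M \<otimes> 1 = 1 \<otimes> B\<close> on \<open>Y \<otimes> X \<otimes> Y\<^sup>*\<close>, where \<open>B\<close> is an automorphism of \<open>X \<otimes> Y\<^sup>*\<close>.
  Tensoring with \<open>Y\<close> and restricting to the direct summand \<open>1\<close> of \<open>Y\<^sup>* \<otimes> Y\<close> shows that \<open>M\<close> comes
  from an endomorphism of \<open>X\<close>, so by Schur's lemma \<open>M\<close> is a scalar \<open>b\<close>. The double braiding of
  \<open>Y\<close> and \<open>X\<^sup>*\<close> is then \<open>1 / b\<close>, and the one of \<open>Y\<close> and \<open>X \<otimes> X\<^sup>*\<close> is \<open>b \<cdot> (1 / b) = 1\<close>.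

  Centralizers are fusion subcategories (\<open>centralizer_fusion\<close>). Hence, if fusion subcategories
  \<open>D\<close> and \<open>E\<^sub>a\<^sub>d\<close> centralize each other, so do \<open>D\<^sub>a\<^sub>d\<close> and \<open>E\<close> (\<open>centralizer_adjoint_objects\<close>).
  If \<open>c\<close> is the nilpotency class, the \<open>c\<close>-th term of the upper central series is generated by the
  unit object and centralizes the whole category, which is the \<open>0\<close>-th term. Moving one adjoint at
  a time to the other side, the \<open>m\<close>-th and the \<open>(c - m)\<close>-th term centralize each other. The
  series is decreasing, so for \<open>2 n \<ge> c\<close> the \<open>n\<close>-th term is contained in the \<open>(c - n)\<close>-th one,
  and therefore centralizes itself.
\<close>

section \<open>Arrows with source and target\<close>

text \<open>
  An arrow of \<open>C\<close> does not determine its source and target. Bundling it with both turns the side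
  conditions of the axioms into equations between \<open>Dom\<close> and \<open>Cod\<close> that rewriting can decide, so
  that the coherence computations below become rewriting in a category.
\<close>

datatype ('o, 'm) arrow = Arrow (Dom: 'o) (Map: 'm) (Cod: 'o)

context linear_category
begin

definition arr :: "('o, 'm) arrow \<Rightarrow> bool" where
  "arr f \<longleftrightarrow> Dom f \<in> Obj C \<and> Cod f \<in> Obj C \<and> Map f \<in> Hom C (Dom f) (Cod f)"

definition compose :: "('o, 'm) arrow \<Rightarrow> ('o, 'm) arrow \<Rightarrow> ('o, 'm) arrow" (infixr \<open>\<circ>\<^sub>t\<close> 70) where
  "g \<circ>\<^sub>t f = Arrow (Dom f) (Map g \<cdot> Map f) (Cod g)"

definition ident :: "'o \<Rightarrow> ('o, 'm) arrow" where
  "ident X = Arrow X (Id C X) X"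

definition inverse_pair :: "('o, 'm) arrow \<Rightarrow> ('o, 'm) arrow \<Rightarrow> bool" where
  "inverse_pair f g \<longleftrightarrow> arr f \<and> arr g \<and> Dom g = Cod f \<and> Cod g = Dom f \<and>
    g \<circ>\<^sub>t f = ident (Dom f) \<and> f \<circ>\<^sub>t g = ident (Cod f)"

text \<open>
  \<open>inverse_arr f\<close> is meaningful only for \<open>f\<close> invertible, and invertibility is expressed by saying
  that it is then an inverse of \<open>f\<close>.
\<close>

definition inverse_arr :: "('o, 'm) arrow \<Rightarrow> ('o, 'm) arrow" where
  "inverse_arr f = Arrow (Cod f) (inv_arrow C (Dom f) (Cod f) (Map f)) (Dom f)"

definition iso_arr :: "('o, 'm) arrow \<Rightarrow> bool" where
  "iso_arr f \<longleftrightarrow> inverse_pair f (inverse_arr f)"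

lemma arr_Arrow [simp]:
  "arr (Arrow X f Y) \<longleftrightarrow> X \<in> Obj C \<and> Y \<in> Obj C \<and> f \<in> Hom C X Y"
  by (simp add: arr_def)

lemma arr_Dom [simp]: "arr f \<Longrightarrow> Dom f \<in> Obj C" and arr_Cod [simp]: "arr f \<Longrightarrow> Cod f \<in> Obj C"
  by (simp_all add: arr_def)

lemma Dom_compose [simp]: "Dom (g \<circ>\<^sub>t f) = Dom f" and Cod_compose [simp]: "Cod (g \<circ>\<^sub>t f) = Cod g"
  by (simp_all add: compose_def)

lemma arr_compose [simp]: "\<lbrakk>arr f; arr g; Dom g = Cod f\<rbrakk> \<Longrightarrow> arr (g \<circ>\<^sub>t f)"
  using Comp_in_Hom by (cases f; cases g) (auto simp: compose_def)

lemma Dom_ident [simp]: "Dom (ident X) = X" and Cod_ident [simp]: "Cod (ident X) = X"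
  by (simp_all add: ident_def)

lemma arr_ident [simp]: "X \<in> Obj C \<Longrightarrow> arr (ident X)"
  by (simp add: ident_def Id_in_Hom)

lemma compose_ident [simp]: "\<lbrakk>arr f; X = Dom f\<rbrakk> \<Longrightarrow> f \<circ>\<^sub>t ident X = f"
  using Comp_Id[of "Dom f" "Cod f" "Map f"] by (cases f) (simp add: compose_def ident_def)

lemma ident_compose [simp]: "\<lbrakk>arr f; X = Cod f\<rbrakk> \<Longrightarrow> ident X \<circ>\<^sub>t f = f"
  using Id_Comp[of "Dom f" "Cod f" "Map f"] by (cases f) (simp add: compose_def ident_def)

lemma compose_assoc [simp]:
  "\<lbrakk>arr f; arr g; arr h; Dom h = Cod g; Dom g = Cod f\<rbrakk> \<Longrightarrow> (h \<circ>\<^sub>t g) \<circ>\<^sub>t f = h \<circ>\<^sub>t (g \<circ>\<^sub>t f)"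
  by (cases f; cases g; cases h)
      (simp add: compose_def Comp_assoc[of "Dom f" "Cod f" "Cod g" "Cod h"])

lemma inverse_pair_unique:
  assumes "inverse_pair f g" "inverse_pair f h"
  shows "g = h"
proof -
  have "g = g \<circ>\<^sub>t (f \<circ>\<^sub>t h)"
    using assms by (simp add: inverse_pair_def)
  also have "\<dots> = (g \<circ>\<^sub>t f) \<circ>\<^sub>t h"
    using assms by (subst compose_assoc) (auto simp: inverse_pair_def)
  also have "\<dots> = h"
    using assms by (simp add: inverse_pair_def)
  finally show ?thesis .
qed

lemma mutually_inverse_iff:
  "\<lbrakk>X \<in> Obj C; Y \<in> Obj C\<rbrakk>
    \<Longrightarrow> mutually_inverse C X Y f g \<longleftrightarrow> inverse_pair (Arrow X f Y) (Arrow Y g X)"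
  by (auto simp: mutually_inverse_def inverse_pair_def compose_def ident_def)

lemma inverse_pair_imp_iso:
  assumes "inverse_pair f g"
  shows "iso_arr f" and "inverse_arr f = g"
proof -
  let ?P = "mutually_inverse C (Dom f) (Cod f) (Map f)"
  have f: "arr f"
    using assms by (simp add: inverse_pair_def)
  obtain m where g: "g = Arrow (Cod f) m (Dom f)"
    using assms by (cases g) (auto simp: inverse_pair_def)
  have eq: "?P h \<longleftrightarrow> inverse_pair f (Arrow (Cod f) h (Dom f))" for h
    using mutually_inverse_iff[of "Dom f" "Cod f" "Map f" h] f by simp
  have "?P m"
    using assms by (simp add: eq g)
  moreover have "h = m" if "?P h" for h
    using that inverse_pair_unique[OF assms] by (auto simp: eq g)
  ultimately have "inv_arrow C (Dom f) (Cod f) (Map f) = m"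
    unfolding inv_arrow_def by (rule the_equality)
  then show "inverse_arr f = g"
    by (simp add: inverse_arr_def g)
  then show "iso_arr f"
    using assms by (simp add: iso_arr_def)
qed

lemma iso_Arrow:
  assumes "X \<in> Obj C" "Y \<in> Obj C"
  shows "iso_arr (Arrow X f Y) \<longleftrightarrow> iso_arrow C X Y f"
proof
  assume "iso_arr (Arrow X f Y)"
  then have "mutually_inverse C X Y f (Map (inverse_arr (Arrow X f Y)))"
    unfolding mutually_inverse_iff[OF assms] iso_arr_def by (simp add: inverse_arr_def)
  then show "iso_arrow C X Y f"
    unfolding iso_arrow_def by blast
next
  assume "iso_arrow C X Y f"
  then obtain g where "inverse_pair (Arrow X f Y) (Arrow Y g X)"
    unfolding iso_arrow_def mutually_inverse_iff[OF assms] by blast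
  then show "iso_arr (Arrow X f Y)"
    by (rule inverse_pair_imp_iso(1))
qed

lemma iso_arr_inverse:
  assumes "iso_arr f"
  shows "arr f" and "arr (inverse_arr f)"
    and "inverse_arr f \<circ>\<^sub>t f = ident (Dom f)" and "f \<circ>\<^sub>t inverse_arr f = ident (Cod f)"
  using assms by (auto simp only: iso_arr_def inverse_pair_def)

declare iso_arr_inverse [simp]

lemma Dom_inverse [simp]: "Dom (inverse_arr f) = Cod f"
  and Cod_inverse [simp]: "Cod (inverse_arr f) = Dom f"
  by (simp_all add: inverse_arr_def)

lemma inverse_compose_compose [simp]:
  "\<lbrakk>iso_arr f; arr g; Cod g = Dom f\<rbrakk> \<Longrightarrow> inverse_arr f \<circ>\<^sub>t (f \<circ>\<^sub>t g) = g"
  by (subst compose_assoc[symmetric]) simp_all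

lemma compose_inverse_compose [simp]:
  "\<lbrakk>iso_arr f; arr g; Cod g = Cod f\<rbrakk> \<Longrightarrow> f \<circ>\<^sub>t (inverse_arr f \<circ>\<^sub>t g) = g"
  by (subst compose_assoc[symmetric]) simp_all

lemma iso_inverse [simp]: "iso_arr f \<Longrightarrow> iso_arr (inverse_arr f)"
  by (rule inverse_pair_imp_iso(1)[where g = f]) (simp add: inverse_pair_def)

lemma iso_compose [simp]: "\<lbrakk>iso_arr f; iso_arr g; Dom g = Cod f\<rbrakk> \<Longrightarrow> iso_arr (g \<circ>\<^sub>t f)"
  by (rule inverse_pair_imp_iso(1)[where g = "inverse_arr f \<circ>\<^sub>t inverse_arr g"])
      (simp add: inverse_pair_def)

lemma iso_cancel_left:
  assumes "f \<circ>\<^sub>t g = f \<circ>\<^sub>t h" "iso_arr f" "arr g" "arr h" "Cod g = Dom f" "Cod h = Dom f"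
  shows "g = h"
  using arg_cong[OF assms(1), of "\<lambda>k. inverse_arr f \<circ>\<^sub>t k"] assms(2-) by simp

lemma iso_cancel_right:
  assumes "g \<circ>\<^sub>t f = h \<circ>\<^sub>t f" "iso_arr f" "arr g" "arr h" "Dom g = Cod f" "Dom h = Cod f"
  shows "g = h"
  using arg_cong[OF assms(1), of "\<lambda>k. k \<circ>\<^sub>t inverse_arr f"] assms(2-) by simp

end


section \<open>Duality in tensor categories\<close>

context tensor_category
begin

definition tens :: "('o, 'm) arrow \<Rightarrow> ('o, 'm) arrow \<Rightarrow> ('o, 'm) arrow" (infixr \<open>\<otimes>\<^sub>t\<close> 75) where
  "f \<otimes>\<^sub>t g = Arrow (Dom f \<otimes>\<^sub>o Dom g) (Map f \<otimes>\<^sub>a Map g) (Cod f \<otimes>\<^sub>o Cod g)"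

definition assoc :: "'o \<Rightarrow> 'o \<Rightarrow> 'o \<Rightarrow> ('o, 'm) arrow" where
  "assoc X Y Z = Arrow ((X \<otimes>\<^sub>o Y) \<otimes>\<^sub>o Z) (Assoc C X Y Z) (X \<otimes>\<^sub>o (Y \<otimes>\<^sub>o Z))"

definition lunit :: "'o \<Rightarrow> ('o, 'm) arrow" where
  "lunit X = Arrow (Unit C \<otimes>\<^sub>o X) (LUnit C X) X"

definition runit :: "'o \<Rightarrow> ('o, 'm) arrow" where
  "runit X = Arrow (X \<otimes>\<^sub>o Unit C) (RUnit C X) X"

declare Unit_in_Obj [simp] TObj_in_Obj [simp]

lemma Dom_tens [simp]: "Dom (f \<otimes>\<^sub>t g) = Dom f \<otimes>\<^sub>o Dom g"
  and Cod_tens [simp]: "Cod (f \<otimes>\<^sub>t g) = Cod f \<otimes>\<^sub>o Cod g"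
  by (simp_all add: tens_def)

lemma arr_tens [simp]: "\<lbrakk>arr f; arr g\<rbrakk> \<Longrightarrow> arr (f \<otimes>\<^sub>t g)"
  by (cases f; cases g) (simp add: tens_def TArr_in_Hom)

lemma ident_tens_ident [simp]: "\<lbrakk>X \<in> Obj C; Y \<in> Obj C\<rbrakk> \<Longrightarrow> ident X \<otimes>\<^sub>t ident Y = ident (X \<otimes>\<^sub>o Y)"
  by (simp add: tens_def ident_def TArr_Id)

text \<open>
  Normal forms of composites: composition is bracketed to the right and adjacent tensor products
  of arrows are merged, which is why the rule is also needed with a continuation \<open>h\<close>.
\<close>

lemma interchange [simp]:
  "\<lbrakk>arr f; arr f'; arr g; arr g'; Dom f' = Cod f; Dom g' = Cod g\<rbrakk>
    \<Longrightarrow> (f' \<otimes>\<^sub>t g') \<circ>\<^sub>t (f \<otimes>\<^sub>t g) = (f' \<circ>\<^sub>t f) \<otimes>\<^sub>t (g' \<circ>\<^sub>t g)"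
  by (cases f; cases g; cases f'; cases g')
      (simp add: tens_def compose_def
          TArr_Comp[symmetric, of "Dom f" "Cod f" "Cod f'" "Dom g" "Cod g" "Cod g'"])

lemma interchange_comp [simp]:
  "\<lbrakk>arr f; arr f'; arr g; arr g'; Dom f' = Cod f; Dom g' = Cod g;
    arr h; Cod h = Dom f \<otimes>\<^sub>o Dom g\<rbrakk>
    \<Longrightarrow> (f' \<otimes>\<^sub>t g') \<circ>\<^sub>t ((f \<otimes>\<^sub>t g) \<circ>\<^sub>t h) = ((f' \<circ>\<^sub>t f) \<otimes>\<^sub>t (g' \<circ>\<^sub>t g)) \<circ>\<^sub>t h"
  by (subst compose_assoc[symmetric]) simp_all

lemma iso_tens [simp]: "\<lbrakk>iso_arr f; iso_arr g\<rbrakk> \<Longrightarrow> iso_arr (f \<otimes>\<^sub>t g)"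
  by (rule inverse_pair_imp_iso(1)[where g = "inverse_arr f \<otimes>\<^sub>t inverse_arr g"])
      (simp add: inverse_pair_def)

lemma iso_ident [simp]: "X \<in> Obj C \<Longrightarrow> iso_arr (ident X)"
  by (rule inverse_pair_imp_iso(1)[where g = "ident X"]) (simp add: inverse_pair_def)

lemma Dom_assoc [simp]: "Dom (assoc X Y Z) = (X \<otimes>\<^sub>o Y) \<otimes>\<^sub>o Z"
  and Cod_assoc [simp]: "Cod (assoc X Y Z) = X \<otimes>\<^sub>o (Y \<otimes>\<^sub>o Z)"
  and Dom_lunit [simp]: "Dom (lunit X) = Unit C \<otimes>\<^sub>o X" and Cod_lunit [simp]: "Cod (lunit X) = X"
  and Dom_runit [simp]: "Dom (runit X) = X \<otimes>\<^sub>o Unit C" and Cod_runit [simp]: "Cod (runit X) = X"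
  by (simp_all add: assoc_def lunit_def runit_def)

lemma iso_assoc [simp]: "\<lbrakk>X \<in> Obj C; Y \<in> Obj C; Z \<in> Obj C\<rbrakk> \<Longrightarrow> iso_arr (assoc X Y Z)"
  and iso_lunit [simp]: "X \<in> Obj C \<Longrightarrow> iso_arr (lunit X)"
  and iso_runit [simp]: "X \<in> Obj C \<Longrightarrow> iso_arr (runit X)"
  by (simp_all add: assoc_def lunit_def runit_def iso_Arrow Assoc_iso LUnit_iso RUnit_iso)

lemma assoc_natural:
  "\<lbrakk>arr f; arr g; arr h; X' = Cod f; Y' = Cod g; Z' = Cod h\<rbrakk>
    \<Longrightarrow> assoc X' Y' Z' \<circ>\<^sub>t ((f \<otimes>\<^sub>t g) \<otimes>\<^sub>t h) = (f \<otimes>\<^sub>t (g \<otimes>\<^sub>t h)) \<circ>\<^sub>t assoc (Dom f) (Dom g) (Dom h)"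
  by (cases f; cases g; cases h) (simp add: tens_def compose_def assoc_def Assoc_natural)

lemma inverse_assoc_natural:
  assumes [simp]: "arr f" "arr g" "arr h" and X': "X' = Cod f" "Y' = Cod g" "Z' = Cod h"
  shows "inverse_arr (assoc X' Y' Z') \<circ>\<^sub>t (f \<otimes>\<^sub>t (g \<otimes>\<^sub>t h)) =
      ((f \<otimes>\<^sub>t g) \<otimes>\<^sub>t h) \<circ>\<^sub>t inverse_arr (assoc (Dom f) (Dom g) (Dom h))"
proof (rule iso_cancel_left[where f = "assoc X' Y' Z'"])
  have "assoc X' Y' Z' \<circ>\<^sub>t ((f \<otimes>\<^sub>t g) \<otimes>\<^sub>t h) \<circ>\<^sub>t inverse_arr (assoc (Dom f) (Dom g) (Dom h)) =
    (assoc X' Y' Z' \<circ>\<^sub>t ((f \<otimes>\<^sub>t g) \<otimes>\<^sub>t h)) \<circ>\<^sub>t inverse_arr (assoc (Dom f) (Dom g) (Dom h))"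
    by (subst compose_assoc) (simp_all add: X')
  then show "assoc X' Y' Z' \<circ>\<^sub>t inverse_arr (assoc X' Y' Z') \<circ>\<^sub>t (f \<otimes>\<^sub>t (g \<otimes>\<^sub>t h)) =
    assoc X' Y' Z' \<circ>\<^sub>t ((f \<otimes>\<^sub>t g) \<otimes>\<^sub>t h) \<circ>\<^sub>t inverse_arr (assoc (Dom f) (Dom g) (Dom h))"
    by (simp add: X' assoc_natural)
qed (simp_all add: X')

lemma runit_natural:
  "\<lbrakk>arr f; Y = Cod f\<rbrakk> \<Longrightarrow> runit Y \<circ>\<^sub>t (f \<otimes>\<^sub>t ident (Unit C)) = f \<circ>\<^sub>t runit (Dom f)"
  by (cases f) (simp add: tens_def compose_def runit_def ident_def RUnit_natural)

lemma pentagon_arr: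
  "\<lbrakk>W \<in> Obj C; X \<in> Obj C; Y \<in> Obj C; Z \<in> Obj C\<rbrakk>
    \<Longrightarrow> assoc W X (Y \<otimes>\<^sub>o Z) \<circ>\<^sub>t assoc (W \<otimes>\<^sub>o X) Y Z
      = (ident W \<otimes>\<^sub>t assoc X Y Z) \<circ>\<^sub>t assoc W (X \<otimes>\<^sub>o Y) Z \<circ>\<^sub>t (assoc W X Y \<otimes>\<^sub>t ident Z)"
  by (simp add: tens_def compose_def assoc_def ident_def pentagon)

lemma tens_ident_Unit_cancel:
  assumes "f \<otimes>\<^sub>t ident (Unit C) = g \<otimes>\<^sub>t ident (Unit C)" "arr f" "arr g" "Dom f = Dom g"
      "Cod f = Cod g"
  shows "f = g"
proof (rule iso_cancel_right[where f = "runit (Dom f)"])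
  show "f \<circ>\<^sub>t runit (Dom f) = g \<circ>\<^sub>t runit (Dom f)"
    using assms by (metis runit_natural)
qed (use assms in simp_all)

text \<open>
  The two sides of the last assumption are the transposes \<open>W \<otimes> V \<rightarrow> Z \<otimes> 1\<close> of \<open>u\<close> and \<open>v\<close>. Bending
  the strand \<open>V\<close> back up with the coevaluation recovers \<open>u\<close> and \<open>v\<close>: the pentagon reduces the
  composite \<open>G\<close> that arises to the zigzag identity, so that \<open>G\<close> is invertible.
\<close>

lemma transpose_injective:
  assumes dual: "is_duality C V Y e c" and [simp]: "V \<in> Obj C" "Y \<in> Obj C" "Z \<in> Obj C"
    and [simp]: "arr u" "arr v" "Dom v = Dom u" "Cod u = Z \<otimes>\<^sub>o Y" "Cod v = Z \<otimes>\<^sub>o Y"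
    and eq: "(ident Z \<otimes>\<^sub>t Arrow (Y \<otimes>\<^sub>o V) e (Unit C)) \<circ>\<^sub>t assoc Z Y V \<circ>\<^sub>t (u \<otimes>\<^sub>t ident V) =
      (ident Z \<otimes>\<^sub>t Arrow (Y \<otimes>\<^sub>o V) e (Unit C)) \<circ>\<^sub>t assoc Z Y V \<circ>\<^sub>t (v \<otimes>\<^sub>t ident V)"
  shows "u = v"
proof -
  let ?e = "Arrow (Y \<otimes>\<^sub>o V) e (Unit C)" and ?c = "Arrow (Unit C) c (V \<otimes>\<^sub>o Y)"
  have [simp]: "e \<in> Hom C (Y \<otimes>\<^sub>o V) (Unit C)" "c \<in> Hom C (Unit C) (V \<otimes>\<^sub>o Y)"
    using dual by (simp_all add: is_duality_def)
  let ?g = "(ident Z \<otimes>\<^sub>t ?e) \<circ>\<^sub>t assoc Z Y V"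
  have zigzag:
      "lunit Y \<circ>\<^sub>t (?e \<otimes>\<^sub>t ident Y) \<circ>\<^sub>t inverse_arr (assoc Y V Y) \<circ>\<^sub>t (ident Y \<otimes>\<^sub>t ?c) = runit Y"
    using dual by
        (simp add: is_duality_def lunit_def runit_def tens_def compose_def inverse_arr_def
            assoc_def ident_def)
  define G where
      "G = (?g \<otimes>\<^sub>t ident Y) \<circ>\<^sub>t inverse_arr (assoc (Z \<otimes>\<^sub>o Y) V Y) \<circ>\<^sub>t (ident (Z \<otimes>\<^sub>o Y) \<otimes>\<^sub>t ?c)"
  \<comment> \<open>The pentagon, solved for the two associators that occur in \<open>G\<close>.\<close>
  have "inverse_arr (assoc Z (Y \<otimes>\<^sub>o V) Y) \<circ>\<^sub>t (ident Z \<otimes>\<^sub>t inverse_arr (assoc Y V Y)) \<circ>\<^sub>t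
      (assoc Z Y (V \<otimes>\<^sub>o Y) \<circ>\<^sub>t assoc (Z \<otimes>\<^sub>o Y) V Y) \<circ>\<^sub>t inverse_arr (assoc (Z \<otimes>\<^sub>o Y) V Y) =
      (assoc Z Y V \<otimes>\<^sub>t ident Y) \<circ>\<^sub>t inverse_arr (assoc (Z \<otimes>\<^sub>o Y) V Y)"
    by (subst pentagon_arr) simp_all
  then have pent: "(assoc Z Y V \<otimes>\<^sub>t ident Y) \<circ>\<^sub>t inverse_arr (assoc (Z \<otimes>\<^sub>o Y) V Y) =
      inverse_arr (assoc Z (Y \<otimes>\<^sub>o V) Y) \<circ>\<^sub>t (ident Z \<otimes>\<^sub>t inverse_arr (assoc Y V Y)) \<circ>\<^sub>t assoc Z Y
          (V \<otimes>\<^sub>o Y)"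
    by simp
  have "(?e \<otimes>\<^sub>t ident Y) \<circ>\<^sub>t inverse_arr (assoc Y V Y) \<circ>\<^sub>t (ident Y \<otimes>\<^sub>t ?c) =
      inverse_arr (lunit Y) \<circ>\<^sub>t runit Y"
    by (simp flip: zigzag)
  moreover have "G = inverse_arr (assoc Z (Unit C) Y) \<circ>\<^sub>t
      (ident Z \<otimes>\<^sub>t ((?e \<otimes>\<^sub>t ident Y) \<circ>\<^sub>t inverse_arr (assoc Y V Y) \<circ>\<^sub>t (ident Y \<otimes>\<^sub>t ?c))) \<circ>\<^sub>t
          assoc Z Y (Unit C)"
  proof -
    have "G = ((ident Z \<otimes>\<^sub>t ?e) \<otimes>\<^sub>t ident Y) \<circ>\<^sub>t
        ((assoc Z Y V \<otimes>\<^sub>t ident Y) \<circ>\<^sub>t inverse_arr (assoc (Z \<otimes>\<^sub>o Y) V Y)) \<circ>\<^sub>t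
            (ident (Z \<otimes>\<^sub>o Y) \<otimes>\<^sub>t ?c)"
      by (simp add: G_def)
    also have "\<dots> = (((ident Z \<otimes>\<^sub>t ?e) \<otimes>\<^sub>t ident Y) \<circ>\<^sub>t inverse_arr (assoc Z (Y \<otimes>\<^sub>o V) Y)) \<circ>\<^sub>t
        (ident Z \<otimes>\<^sub>t inverse_arr (assoc Y V Y)) \<circ>\<^sub>t
        (assoc Z Y (V \<otimes>\<^sub>o Y) \<circ>\<^sub>t ((ident Z \<otimes>\<^sub>t ident Y) \<otimes>\<^sub>t ?c))"
      unfolding pent by simp
    also have "((ident Z \<otimes>\<^sub>t ?e) \<otimes>\<^sub>t ident Y) \<circ>\<^sub>t inverse_arr (assoc Z (Y \<otimes>\<^sub>o V) Y) =
        inverse_arr (assoc Z (Unit C) Y) \<circ>\<^sub>t (ident Z \<otimes>\<^sub>t (?e \<otimes>\<^sub>t ident Y))"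
      by (simp add: inverse_assoc_natural)
    also have "assoc Z Y (V \<otimes>\<^sub>o Y) \<circ>\<^sub>t ((ident Z \<otimes>\<^sub>t ident Y) \<otimes>\<^sub>t ?c) =
        (ident Z \<otimes>\<^sub>t (ident Y \<otimes>\<^sub>t ?c)) \<circ>\<^sub>t assoc Z Y (Unit C)"
      by (subst assoc_natural) simp_all
    finally show ?thesis
      by simp
  qed
  ultimately have "iso_arr G"
    by simp
  have absorb: "G \<circ>\<^sub>t (w \<otimes>\<^sub>t ident (Unit C)) =
      ((?g \<circ>\<^sub>t (w \<otimes>\<^sub>t ident V)) \<otimes>\<^sub>t ident Y) \<circ>\<^sub>t inverse_arr (assoc (Dom w) V Y) \<circ>\<^sub>t
          (ident (Dom w) \<otimes>\<^sub>t ?c)"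
    if [simp]: "arr w" "Cod w = Z \<otimes>\<^sub>o Y" for w
  proof -
    have "G \<circ>\<^sub>t (w \<otimes>\<^sub>t ident (Unit C)) = (?g \<otimes>\<^sub>t ident Y) \<circ>\<^sub>t
        (inverse_arr (assoc (Z \<otimes>\<^sub>o Y) V Y) \<circ>\<^sub>t (w \<otimes>\<^sub>t (ident V \<otimes>\<^sub>t ident Y))) \<circ>\<^sub>t
            (ident (Dom w) \<otimes>\<^sub>t ?c)"
      by (simp add: G_def)
    also have "\<dots> = (?g \<otimes>\<^sub>t ident Y) \<circ>\<^sub>t
        (((w \<otimes>\<^sub>t ident V) \<otimes>\<^sub>t ident Y) \<circ>\<^sub>t inverse_arr (assoc (Dom w) V Y)) \<circ>\<^sub>t
            (ident (Dom w) \<otimes>\<^sub>t ?c)"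
      by (subst inverse_assoc_natural) simp_all
    finally show ?thesis
      by simp
  qed
  have "G \<circ>\<^sub>t (u \<otimes>\<^sub>t ident (Unit C)) = G \<circ>\<^sub>t (v \<otimes>\<^sub>t ident (Unit C))"
    using eq by (simp add: absorb)
  then have "u \<otimes>\<^sub>t ident (Unit C) = v \<otimes>\<^sub>t ident (Unit C)"
    by (rule iso_cancel_left) (simp_all add: \<open>iso_arr G\<close>, simp_all add: G_def)
  then show "u = v"
    by (rule tens_ident_Unit_cancel) simp_all
qed

end


section \<open>Scalars, monomorphisms and sliding\<close>

context linear_category
begin

definition mono_arr :: "('o, 'm) arrow \<Rightarrow> bool" where
  "mono_arr f \<longleftrightarrow> arr f \<and> (\<forall>u v. arr u \<and> arr v \<and> Dom u = Dom v \<and> Cod u = Dom f \<and> Cod v = Dom f \<and>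
    f \<circ>\<^sub>t u = f \<circ>\<^sub>t v \<longrightarrow> u = v)"

lemma mono_arrI:
  "\<lbrakk>arr f; \<And>u v. \<lbrakk>arr u; arr v; Dom u = Dom v; Cod u = Dom f; Cod v = Dom f; f \<circ>\<^sub>t u = f \<circ>\<^sub>t v\<rbrakk> \<Longrightarrow>
      u = v\<rbrakk>
    \<Longrightarrow> mono_arr f"
  unfolding mono_arr_def by blast

lemma mono_arrD:
  "\<lbrakk>mono_arr f; f \<circ>\<^sub>t u = f \<circ>\<^sub>t v; arr u; arr v; Dom u = Dom v; Cod u = Dom f; Cod v = Dom f\<rbrakk> \<Longrightarrow>
      u = v"
  unfolding mono_arr_def by blast

lemma mono_arr_Arrow:
  assumes "X \<in> Obj C" "Y \<in> Obj C" and f: "mono_arrow C X Y f"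
  shows "mono_arr (Arrow X f Y)"
proof (rule mono_arrI)
  show "arr (Arrow X f Y)"
    using assms unfolding mono_arrow_def arr_Arrow by blast
next
  fix u v
  assume uv: "arr u" "arr v" "Dom u = Dom v" "Cod u = Dom (Arrow X f Y)"
      "Cod v = Dom (Arrow X f Y)"
    and eq: "Arrow X f Y \<circ>\<^sub>t u = Arrow X f Y \<circ>\<^sub>t v"
  have "Map u \<in> Hom C (Dom u) X" "Map v \<in> Hom C (Dom u) X" "Dom u \<in> Obj C"
    using uv unfolding arr_def by simp_all
  moreover have "f \<cdot> Map u = f \<cdot> Map v"
    using eq by (simp add: compose_def)
  ultimately have "Map u = Map v"
    using f unfolding mono_arrow_def by blast
  then show "u = v"
    using uv by (intro arrow.expand) simp_all
qed

definition scalar :: "'k \<Rightarrow> 'o \<Rightarrow> ('o, 'm) arrow" where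
  "scalar a X = Arrow X (Scale C a (Id C X)) X"

lemma Dom_scalar [simp]: "Dom (scalar a X) = X" and Cod_scalar [simp]: "Cod (scalar a X) = X"
  by (simp_all add: scalar_def)

lemma arr_scalar [simp]: "X \<in> Obj C \<Longrightarrow> arr (scalar a X)"
  by (simp add: scalar_def Id_in_Hom Hom_subspace subspace_scale)

lemma scalar_1: "scalar 1 X = ident X"
  by (simp add: scalar_def ident_def)

lemma scalar_compose:
  "\<lbrakk>arr f; Y = Cod f\<rbrakk> \<Longrightarrow> scalar a Y \<circ>\<^sub>t f = Arrow (Dom f) (Scale C a (Map f)) (Cod f)"
  using Comp_scale_left[of "Dom f" "Cod f" "Cod f" "Map f" "Id C (Cod f)" a]
      Id_Comp[of "Dom f" "Cod f" "Map f"]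
  by (cases f) (simp add: scalar_def compose_def Id_in_Hom)

lemma compose_scalar:
  "\<lbrakk>arr f; X = Dom f\<rbrakk> \<Longrightarrow> f \<circ>\<^sub>t scalar a X = Arrow (Dom f) (Scale C a (Map f)) (Cod f)"
  using Comp_scale_right[of "Dom f" "Dom f" "Cod f" "Id C (Dom f)" "Map f" a]
      Comp_Id[of "Dom f" "Cod f" "Map f"]
  by (cases f) (simp add: scalar_def compose_def Id_in_Hom)

lemma scalar_central: "\<lbrakk>arr f; X = Dom f\<rbrakk> \<Longrightarrow> f \<circ>\<^sub>t scalar a X = scalar a (Cod f) \<circ>\<^sub>t f"
  by (simp add: scalar_compose compose_scalar)

lemma scalar_mult [simp]: "X \<in> Obj C \<Longrightarrow> scalar a X \<circ>\<^sub>t scalar b X = scalar (a * b) X"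
  by (simp add: scalar_compose) (simp add: scalar_def)

text \<open>
  A multiple of the identity that is invertible need not have a nonzero coefficient: on a zero
  object all coefficients give the same arrow, and then \<open>1\<close> can be chosen.
\<close>

lemma iso_scalar_nonzero:
  assumes "iso_arr (scalar a X)"
  shows "\<exists>b. b \<noteq> 0 \<and> scalar a X = scalar b X"
proof (cases "a = 0")
  case True
  have X: "X \<in> Obj C"
    using iso_arr_inverse(1)[OF assms] by (simp add: scalar_def)
  have "ident X = scalar a X \<circ>\<^sub>t inverse_arr (scalar a X)"
    using assms by simp
  also have "\<dots> = Arrow X 0 X"
    using assms True by (subst scalar_compose) simp_all
  finally have "scalar a X = scalar 1 X"
    using True by (simp add: scalar_def ident_def)
  then show ?thesis
    by (intro exI[of _ 1]) simp
qed auto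

end

context tensor_category
begin

lemma ident_tens_scalar: "\<lbrakk>X \<in> Obj C; Y \<in> Obj C\<rbrakk> \<Longrightarrow> ident X \<otimes>\<^sub>t scalar a Y = scalar a (X \<otimes>\<^sub>o Y)"
  and scalar_tens_ident: "\<lbrakk>X \<in> Obj C; Y \<in> Obj C\<rbrakk> \<Longrightarrow> scalar a X \<otimes>\<^sub>t ident Y = scalar a (X \<otimes>\<^sub>o Y)"
  using TArr_scale_left[of X X Y Y "Id C X" "Id C Y" a]
      TArr_scale_right[of X X Y Y "Id C X" "Id C Y" a]
  by (simp_all add: tens_def ident_def scalar_def Id_in_Hom TArr_Id)

text \<open>
  An endomorphism \<open>A\<close> of \<open>Y \<otimes> X\<close> slides past \<open>V\<close> if \<open>A \<otimes> 1\<^sub>V = 1\<^sub>Y \<otimes> B\<close> for some \<open>B\<close>, up to the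
  associator: in the presence of \<open>V\<close>, \<open>A\<close> no longer acts on \<open>Y\<close>.
\<close>

definition slides :: "('o, 'm) arrow \<Rightarrow> 'o \<Rightarrow> 'o \<Rightarrow> 'o \<Rightarrow> bool" where
  "slides A Y X V \<longleftrightarrow> (\<exists>B. arr B \<and> Dom B = X \<otimes>\<^sub>o V \<and> Cod B = X \<otimes>\<^sub>o V \<and>
    assoc Y X V \<circ>\<^sub>t (A \<otimes>\<^sub>t ident V) = (ident Y \<otimes>\<^sub>t B) \<circ>\<^sub>t assoc Y X V)"

text \<open>
  Tensor \<open>A \<otimes> 1 = 1 \<otimes> B\<close> with the identity of \<open>W\<close>; the pentagon identifies the two ways to
  regroup the four factors.
\<close>

lemma slides_tens:
  assumes "slides A Y X V"
    and [simp]: "arr A" "Dom A = Y \<otimes>\<^sub>o X" "Cod A = Y \<otimes>\<^sub>o X"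
      "X \<in> Obj C" "Y \<in> Obj C" "V \<in> Obj C" "W \<in> Obj C"
  shows "slides A Y X (V \<otimes>\<^sub>o W)"
proof -
  obtain B where [simp]: "arr B" "Dom B = X \<otimes>\<^sub>o V" "Cod B = X \<otimes>\<^sub>o V"
    and B: "assoc Y X V \<circ>\<^sub>t (A \<otimes>\<^sub>t ident V) = (ident Y \<otimes>\<^sub>t B) \<circ>\<^sub>t assoc Y X V"
    using assms(1) by (auto simp: slides_def)
  define B' where "B' = assoc X V W \<circ>\<^sub>t (B \<otimes>\<^sub>t ident W) \<circ>\<^sub>t inverse_arr (assoc X V W)"
  have [simp]: "arr B'" "Dom B' = X \<otimes>\<^sub>o V \<otimes>\<^sub>o W" "Cod B' = X \<otimes>\<^sub>o V \<otimes>\<^sub>o W"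
    by (simp_all add: B'_def)
  let ?a = "assoc (Y \<otimes>\<^sub>o X) V W"
  \<comment> \<open>Both sides are compared after precomposition with \<open>?a\<close>, where the pentagon applies.\<close>
  have "assoc Y X (V \<otimes>\<^sub>o W) \<circ>\<^sub>t (A \<otimes>\<^sub>t ident (V \<otimes>\<^sub>o W)) = (ident Y \<otimes>\<^sub>t B') \<circ>\<^sub>t assoc Y X (V \<otimes>\<^sub>o W)"
  proof (rule iso_cancel_right[where f = ?a])
    have "(assoc Y X (V \<otimes>\<^sub>o W) \<circ>\<^sub>t (A \<otimes>\<^sub>t ident (V \<otimes>\<^sub>o W))) \<circ>\<^sub>t ?a =
      assoc Y X (V \<otimes>\<^sub>o W) \<circ>\<^sub>t (A \<otimes>\<^sub>t (ident V \<otimes>\<^sub>t ident W)) \<circ>\<^sub>t ?a"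
      by simp
    also have "(A \<otimes>\<^sub>t (ident V \<otimes>\<^sub>t ident W)) \<circ>\<^sub>t ?a = ?a \<circ>\<^sub>t ((A \<otimes>\<^sub>t ident V) \<otimes>\<^sub>t ident W)"
      by (subst assoc_natural) simp_all
    also have "assoc Y X (V \<otimes>\<^sub>o W) \<circ>\<^sub>t ?a \<circ>\<^sub>t ((A \<otimes>\<^sub>t ident V) \<otimes>\<^sub>t ident W) =
      (assoc Y X (V \<otimes>\<^sub>o W) \<circ>\<^sub>t ?a) \<circ>\<^sub>t ((A \<otimes>\<^sub>t ident V) \<otimes>\<^sub>t ident W)"
      by simp
    also have "\<dots> = (ident Y \<otimes>\<^sub>t assoc X V W) \<circ>\<^sub>t assoc Y (X \<otimes>\<^sub>o V) W \<circ>\<^sub>t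
        ((assoc Y X V \<circ>\<^sub>t (A \<otimes>\<^sub>t ident V)) \<otimes>\<^sub>t ident W)"
      unfolding pentagon_arr[OF \<open>Y \<in> Obj C\<close> \<open>X \<in> Obj C\<close> \<open>V \<in> Obj C\<close> \<open>W \<in> Obj C\<close>] by simp
    also have "\<dots> = (ident Y \<otimes>\<^sub>t assoc X V W) \<circ>\<^sub>t (assoc Y (X \<otimes>\<^sub>o V) W \<circ>\<^sub>t
        ((ident Y \<otimes>\<^sub>t B) \<otimes>\<^sub>t ident W)) \<circ>\<^sub>t (assoc Y X V \<otimes>\<^sub>t ident W)"
      unfolding B by simp
    also have
        "\<dots> = (ident Y \<otimes>\<^sub>t B') \<circ>\<^sub>t (ident Y \<otimes>\<^sub>t assoc X V W) \<circ>\<^sub>t assoc Y (X \<otimes>\<^sub>o V) W \<circ>\<^sub>t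
            (assoc Y X V \<otimes>\<^sub>t ident W)"
      by (subst assoc_natural) (simp_all add: B'_def)
    also have "\<dots> = ((ident Y \<otimes>\<^sub>t B') \<circ>\<^sub>t assoc Y X (V \<otimes>\<^sub>o W)) \<circ>\<^sub>t ?a"
      by (simp add: pentagon_arr)
    finally show "(assoc Y X (V \<otimes>\<^sub>o W) \<circ>\<^sub>t (A \<otimes>\<^sub>t ident (V \<otimes>\<^sub>o W))) \<circ>\<^sub>t ?a =
      ((ident Y \<otimes>\<^sub>t B') \<circ>\<^sub>t assoc Y X (V \<otimes>\<^sub>o W)) \<circ>\<^sub>t ?a" .
  qed simp_all
  then show ?thesis
    unfolding slides_def by (intro exI[of _ B']) simp
qed

text \<open>
  If \<open>U\<close> is a retract of \<open>V\<close>, compress \<open>B\<close> from \<open>X \<otimes> V\<close> to \<open>X \<otimes> U\<close>.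
\<close>

lemma slides_retract:
  assumes "slides A Y X V"
    and [simp]: "arr A" "Dom A = Y \<otimes>\<^sub>o X" "Cod A = Y \<otimes>\<^sub>o X" "X \<in> Obj C" "Y \<in> Obj C"
      "arr r" "arr s" "Dom r = V" "Cod r = U" "Dom s = U" "Cod s = V"
    and rs: "r \<circ>\<^sub>t s = ident U"
  shows "slides A Y X U"
proof -
  have [simp]: "U \<in> Obj C" "V \<in> Obj C"
    using arr_Dom[of r] arr_Cod[of r] by simp_all
  obtain B where [simp]: "arr B" "Dom B = X \<otimes>\<^sub>o V" "Cod B = X \<otimes>\<^sub>o V"
    and B: "assoc Y X V \<circ>\<^sub>t (A \<otimes>\<^sub>t ident V) = (ident Y \<otimes>\<^sub>t B) \<circ>\<^sub>t assoc Y X V"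
    using assms(1) by (auto simp: slides_def)
  define B' where "B' = (ident X \<otimes>\<^sub>t r) \<circ>\<^sub>t B \<circ>\<^sub>t (ident X \<otimes>\<^sub>t s)"
  have [simp]: "arr B'" "Dom B' = X \<otimes>\<^sub>o U" "Cod B' = X \<otimes>\<^sub>o U"
    by (simp_all add: B'_def)
  have "assoc Y X U \<circ>\<^sub>t (A \<otimes>\<^sub>t ident U) =
      (assoc Y X U \<circ>\<^sub>t ((ident Y \<otimes>\<^sub>t ident X) \<otimes>\<^sub>t r)) \<circ>\<^sub>t (A \<otimes>\<^sub>t ident V) \<circ>\<^sub>t
          (ident (Y \<otimes>\<^sub>o X) \<otimes>\<^sub>t s)"
    by (simp add: rs)
  also have
      "\<dots> = (ident Y \<otimes>\<^sub>t (ident X \<otimes>\<^sub>t r)) \<circ>\<^sub>t (assoc Y X V \<circ>\<^sub>t (A \<otimes>\<^sub>t ident V)) \<circ>\<^sub>t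
          (ident (Y \<otimes>\<^sub>o X) \<otimes>\<^sub>t s)"
    by (subst assoc_natural) simp_all
  also have "\<dots> = (ident Y \<otimes>\<^sub>t ((ident X \<otimes>\<^sub>t r) \<circ>\<^sub>t B)) \<circ>\<^sub>t
      (assoc Y X V \<circ>\<^sub>t ((ident Y \<otimes>\<^sub>t ident X) \<otimes>\<^sub>t s))"
    unfolding B by simp
  also have "\<dots> = (ident Y \<otimes>\<^sub>t B') \<circ>\<^sub>t assoc Y X U"
    by (subst assoc_natural) (simp_all add: B'_def)
  finally show ?thesis
    unfolding slides_def by (intro exI[of _ B']) simp
qed

text \<open>
  Past the unit object, sliding means \<open>A = 1\<^sub>Y \<otimes> B\<close> with \<open>B\<close> an endomorphism of \<open>X \<otimes> 1\<close>, hence of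
  \<open>X\<close>; if \<open>X\<close> has only scalar endomorphisms, \<open>A\<close> is a scalar too.
\<close>

lemma slides_Unit_scalar:
  assumes "slides A Y X (Unit C)"
    and [simp]: "arr A" "Dom A = Y \<otimes>\<^sub>o X" "Cod A = Y \<otimes>\<^sub>o X" "X \<in> Obj C" "Y \<in> Obj C"
    and schur: "\<And>f. f \<in> Hom C X X \<Longrightarrow> \<exists>a. f = Scale C a (Id C X)"
  shows "\<exists>a. A = scalar a (Y \<otimes>\<^sub>o X)"
proof -
  obtain B where [simp]: "arr B" "Dom B = X \<otimes>\<^sub>o Unit C" "Cod B = X \<otimes>\<^sub>o Unit C"
    and B: "assoc Y X (Unit C) \<circ>\<^sub>t (A \<otimes>\<^sub>t ident (Unit C)) = (ident Y \<otimes>\<^sub>t B) \<circ>\<^sub>t assoc Y X (Unit C)"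
    using assms(1) by (auto simp: slides_def)
  let ?f = "runit X \<circ>\<^sub>t B \<circ>\<^sub>t inverse_arr (runit X)"
  have "arr ?f"
    by simp
  then have "Map ?f \<in> Hom C X X"
    unfolding arr_def by simp
  then obtain a where "Map ?f = Scale C a (Id C X)"
    using schur by blast
  then have f: "?f = scalar a X"
    by (intro arrow.expand) (simp_all add: scalar_def)
  have "B = inverse_arr (runit X) \<circ>\<^sub>t ?f \<circ>\<^sub>t runit X"
    by simp
  also have "\<dots> = scalar a (X \<otimes>\<^sub>o Unit C)"
  proof -
    have "scalar a X \<circ>\<^sub>t runit X = runit X \<circ>\<^sub>t scalar a (X \<otimes>\<^sub>o Unit C)"
      by (simp add: scalar_central)
    then show ?thesis
      unfolding f by simp
  qed
  finally have "B = scalar a (X \<otimes>\<^sub>o Unit C)" .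
  then have "assoc Y X (Unit C) \<circ>\<^sub>t (A \<otimes>\<^sub>t ident (Unit C)) =
      assoc Y X (Unit C) \<circ>\<^sub>t (scalar a (Y \<otimes>\<^sub>o X) \<otimes>\<^sub>t ident (Unit C))"
    using B by (simp add: ident_tens_scalar scalar_tens_ident scalar_central)
  then have "A \<otimes>\<^sub>t ident (Unit C) = scalar a (Y \<otimes>\<^sub>o X) \<otimes>\<^sub>t ident (Unit C)"
    by (rule iso_cancel_left) simp_all
  then have "A = scalar a (Y \<otimes>\<^sub>o X)"
    by (rule tens_ident_Unit_cancel) simp_all
  then show ?thesis ..
qed

end

context rigid_category
begin

text \<open>
  Tensoring with \<open>Y\<close> is right adjoint to tensoring with the right dual \<open>V\<close> of \<open>Y\<close>, so it
  preserves monomorphisms: two arrows into \<open>Dom f \<otimes> Y\<close> that become equal after \<open>f \<otimes> 1\<close> have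
  transposes that become equal after \<open>f\<close>.
\<close>

lemma mono_tens_ident:
  assumes f: "mono_arr f" and [simp]: "Y \<in> Obj C"
  shows "mono_arr (f \<otimes>\<^sub>t ident Y)"
proof -
  have [simp]: "arr f"
    using f unfolding mono_arr_def by blast
  obtain V e c where [simp]: "V \<in> Obj C" and dual: "is_duality C V Y e c"
    using right_dual_exists[of Y] by auto
  let ?e = "Arrow (Y \<otimes>\<^sub>o V) e (Unit C)"
  have [simp]: "e \<in> Hom C (Y \<otimes>\<^sub>o V) (Unit C)"
    using dual by (simp add: is_duality_def)
  show ?thesis
  proof (rule mono_arrI)
    fix u v
    assume [simp]: "arr u" "arr v" "Dom u = Dom v" and "Cod u = Dom (f \<otimes>\<^sub>t ident Y)"
        "Cod v = Dom (f \<otimes>\<^sub>t ident Y)"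
      and eq: "(f \<otimes>\<^sub>t ident Y) \<circ>\<^sub>t u = (f \<otimes>\<^sub>t ident Y) \<circ>\<^sub>t v"
    then have [simp]: "Cod u = Dom f \<otimes>\<^sub>o Y" "Cod v = Dom f \<otimes>\<^sub>o Y"
      by simp_all
    let ?t = "\<lambda>w. (ident (Dom f) \<otimes>\<^sub>t ?e) \<circ>\<^sub>t assoc (Dom f) Y V \<circ>\<^sub>t (w \<otimes>\<^sub>t ident V)"
    have t: "f \<circ>\<^sub>t runit (Dom f) \<circ>\<^sub>t ?t w =
        runit (Cod f) \<circ>\<^sub>t (ident (Cod f) \<otimes>\<^sub>t ?e) \<circ>\<^sub>t assoc (Cod f) Y V \<circ>\<^sub>t
        (((f \<otimes>\<^sub>t ident Y) \<circ>\<^sub>t w) \<otimes>\<^sub>t ident V)" if [simp]: "arr w" "Cod w = Dom f \<otimes>\<^sub>o Y" for w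
    proof -
      have "f \<circ>\<^sub>t runit (Dom f) \<circ>\<^sub>t ?t w = (f \<circ>\<^sub>t runit (Dom f)) \<circ>\<^sub>t ?t w"
        by simp
      also have "\<dots> = runit (Cod f) \<circ>\<^sub>t (ident (Cod f) \<otimes>\<^sub>t ?e) \<circ>\<^sub>t
          ((f \<otimes>\<^sub>t (ident Y \<otimes>\<^sub>t ident V)) \<circ>\<^sub>t assoc (Dom f) Y V) \<circ>\<^sub>t (w \<otimes>\<^sub>t ident V)"
        by (subst runit_natural[of f "Cod f", symmetric]) simp_all
      also have "(f \<otimes>\<^sub>t (ident Y \<otimes>\<^sub>t ident V)) \<circ>\<^sub>t assoc (Dom f) Y V =
          assoc (Cod f) Y V \<circ>\<^sub>t ((f \<otimes>\<^sub>t ident Y) \<otimes>\<^sub>t ident V)"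
        by (subst assoc_natural) simp_all
      finally show ?thesis
        by simp
    qed
    have "f \<circ>\<^sub>t runit (Dom f) \<circ>\<^sub>t ?t u = f \<circ>\<^sub>t runit (Dom f) \<circ>\<^sub>t ?t v"
      unfolding t[OF \<open>arr u\<close> \<open>Cod u = Dom f \<otimes>\<^sub>o Y\<close>] t[OF \<open>arr v\<close> \<open>Cod v = Dom f \<otimes>\<^sub>o Y\<close>] eq ..
    then have "runit (Dom f) \<circ>\<^sub>t ?t u = runit (Dom f) \<circ>\<^sub>t ?t v"
      by (rule mono_arrD[OF f]) simp_all
    then have "?t u = ?t v"
      by (rule iso_cancel_left) simp_all
    then show "u = v"
      by (rule transpose_injective[OF dual, rotated -1]) simp_all
  qed simp
qed

end


section \<open>The double braiding\<close>

context braided_fusion_category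
begin

definition braid :: "'o \<Rightarrow> 'o \<Rightarrow> ('o, 'm) arrow" where
  "braid X Y = Arrow (X \<otimes>\<^sub>o Y) (Braid C X Y) (Y \<otimes>\<^sub>o X)"

definition monodromy :: "'o \<Rightarrow> 'o \<Rightarrow> ('o, 'm) arrow" where
  "monodromy X Y = braid Y X \<circ>\<^sub>t braid X Y"

definition ev :: "'o \<Rightarrow> ('o, 'm) arrow" where
  "ev X = Arrow (Dual C X \<otimes>\<^sub>o X) (Ev C X) (Unit C)"

declare Dual_in_Obj [simp]

lemma Dom_braid [simp]: "Dom (braid X Y) = X \<otimes>\<^sub>o Y"
  and Cod_braid [simp]: "Cod (braid X Y) = Y \<otimes>\<^sub>o X"
  and Dom_monodromy [simp]: "Dom (monodromy X Y) = X \<otimes>\<^sub>o Y"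
  and Cod_monodromy [simp]: "Cod (monodromy X Y) = X \<otimes>\<^sub>o Y"
  and Dom_ev [simp]: "Dom (ev X) = Dual C X \<otimes>\<^sub>o X" and Cod_ev [simp]: "Cod (ev X) = Unit C"
  by (simp_all add: braid_def monodromy_def ev_def)

lemma iso_braid [simp]: "\<lbrakk>X \<in> Obj C; Y \<in> Obj C\<rbrakk> \<Longrightarrow> iso_arr (braid X Y)"
  by (simp add: braid_def iso_Arrow Braid_iso)

lemma iso_monodromy [simp]: "\<lbrakk>X \<in> Obj C; Y \<in> Obj C\<rbrakk> \<Longrightarrow> iso_arr (monodromy X Y)"
  by (simp add: monodromy_def)

lemma arr_ev [simp]: "X \<in> Obj C \<Longrightarrow> arr (ev X)"
  using Dual_is_left_dual[of X] by (simp add: ev_def is_duality_def)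

lemma monodromy_eq_ident_iff:
  "monodromy X Y = ident (X \<otimes>\<^sub>o Y) \<longleftrightarrow> double_braiding C X Y = Id C (X \<otimes>\<^sub>o Y)"
  by (simp add: monodromy_def braid_def compose_def ident_def double_braiding_def)

lemma braid_natural:
  "\<lbrakk>arr f; arr g; X' = Cod f; Y' = Cod g\<rbrakk>
    \<Longrightarrow> braid X' Y' \<circ>\<^sub>t (f \<otimes>\<^sub>t g) = (g \<otimes>\<^sub>t f) \<circ>\<^sub>t braid (Dom f) (Dom g)"
  by (cases f; cases g) (simp add: braid_def tens_def compose_def Braid_natural)

lemma monodromy_natural:
  assumes [simp]: "arr f" "arr g" and X': "X' = Cod f" "Y' = Cod g"
  shows "monodromy X' Y' \<circ>\<^sub>t (f \<otimes>\<^sub>t g) = (f \<otimes>\<^sub>t g) \<circ>\<^sub>t monodromy (Dom f) (Dom g)"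
proof -
  have "monodromy X' Y' \<circ>\<^sub>t (f \<otimes>\<^sub>t g) = braid Y' X' \<circ>\<^sub>t (braid X' Y' \<circ>\<^sub>t (f \<otimes>\<^sub>t g))"
    using X' by (simp add: monodromy_def)
  also have "braid X' Y' \<circ>\<^sub>t (f \<otimes>\<^sub>t g) = (g \<otimes>\<^sub>t f) \<circ>\<^sub>t braid (Dom f) (Dom g)"
    using X' by (simp add: braid_natural)
  also have "braid Y' X' \<circ>\<^sub>t (g \<otimes>\<^sub>t f) \<circ>\<^sub>t braid (Dom f) (Dom g) =
      (braid Y' X' \<circ>\<^sub>t (g \<otimes>\<^sub>t f)) \<circ>\<^sub>t braid (Dom f) (Dom g)"
    using X' by simp
  also have "braid Y' X' \<circ>\<^sub>t (g \<otimes>\<^sub>t f) = (f \<otimes>\<^sub>t g) \<circ>\<^sub>t braid (Dom g) (Dom f)"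
    using X' by (simp add: braid_natural)
  also have "((f \<otimes>\<^sub>t g) \<circ>\<^sub>t braid (Dom g) (Dom f)) \<circ>\<^sub>t braid (Dom f) (Dom g) =
      (f \<otimes>\<^sub>t g) \<circ>\<^sub>t monodromy (Dom f) (Dom g)"
    by (simp add: monodromy_def)
  finally show ?thesis .
qed

lemma hexagon_arr:
  "\<lbrakk>X \<in> Obj C; Y \<in> Obj C; Z \<in> Obj C\<rbrakk>
    \<Longrightarrow> assoc Y Z X \<circ>\<^sub>t braid X (Y \<otimes>\<^sub>o Z) \<circ>\<^sub>t assoc X Y Z
      = (ident Y \<otimes>\<^sub>t braid X Z) \<circ>\<^sub>t assoc Y X Z \<circ>\<^sub>t (braid X Y \<otimes>\<^sub>t ident Z)"
  using hexagon[of X Y Z] by (simp add: assoc_def braid_def tens_def compose_def ident_def)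

lemma hexagon'_arr:
  "\<lbrakk>X \<in> Obj C; Y \<in> Obj C; Z \<in> Obj C\<rbrakk>
    \<Longrightarrow> inverse_arr (assoc Z X Y) \<circ>\<^sub>t braid (X \<otimes>\<^sub>o Y) Z \<circ>\<^sub>t inverse_arr (assoc X Y Z)
      = (braid X Z \<otimes>\<^sub>t ident Y) \<circ>\<^sub>t inverse_arr (assoc X Z Y) \<circ>\<^sub>t (ident X \<otimes>\<^sub>t braid Y Z)"
  using hexagon'[of X Y Z]
  by (simp add: assoc_def braid_def tens_def compose_def ident_def inverse_arr_def)

text \<open>
  The composite of the two hexagons: \<open>X\<close> passes \<open>Y\<close>, goes around \<open>Z\<close>, and passes \<open>Y\<close> again.
\<close>

lemma monodromy_TObj:
  assumes [simp]: "X \<in> Obj C" "Y \<in> Obj C" "Z \<in> Obj C"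
  shows "inverse_arr (assoc X Y Z) \<circ>\<^sub>t monodromy X (Y \<otimes>\<^sub>o Z) \<circ>\<^sub>t assoc X Y Z =
    (braid Y X \<otimes>\<^sub>t ident Z) \<circ>\<^sub>t
      (inverse_arr (assoc Y X Z) \<circ>\<^sub>t (ident Y \<otimes>\<^sub>t monodromy X Z) \<circ>\<^sub>t assoc Y X Z) \<circ>\<^sub>t
      (braid X Y \<otimes>\<^sub>t ident Z)"
proof -
  have "inverse_arr (assoc X Y Z) \<circ>\<^sub>t monodromy X (Y \<otimes>\<^sub>o Z) \<circ>\<^sub>t assoc X Y Z =
      (inverse_arr (assoc X Y Z) \<circ>\<^sub>t braid (Y \<otimes>\<^sub>o Z) X \<circ>\<^sub>t inverse_arr (assoc Y Z X)) \<circ>\<^sub>t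
      (assoc Y Z X \<circ>\<^sub>t braid X (Y \<otimes>\<^sub>o Z) \<circ>\<^sub>t assoc X Y Z)"
    by (simp add: monodromy_def)
  also have "\<dots> = (braid Y X \<otimes>\<^sub>t ident Z) \<circ>\<^sub>t
      (inverse_arr (assoc Y X Z) \<circ>\<^sub>t (ident Y \<otimes>\<^sub>t monodromy X Z) \<circ>\<^sub>t assoc Y X Z) \<circ>\<^sub>t
      (braid X Y \<otimes>\<^sub>t ident Z)"
    by (subst hexagon_arr, simp, simp, simp, subst hexagon'_arr) (simp_all add: monodromy_def)
  finally show ?thesis .
qed

text \<open>
  The double braidings that matter are those where \<open>Z\<close> is only a spectator, so that they are
  given by an endomorphism \<open>m\<close> of \<open>X\<close>: for \<open>m = 1\<close> the objects \<open>X\<close> and \<open>Z\<close> centralize each other,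
  for scalar \<open>m\<close> they do so projectively. Then \<open>m\<close> can be pulled out of the formula for \<open>Y \<otimes> Z\<close>
  by naturality.
\<close>

lemma monodromy_TObj_left_action:
  assumes [simp]: "X \<in> Obj C" "Y \<in> Obj C" "Z \<in> Obj C" "arr m" "Dom m = X" "Cod m = X"
    and Z: "monodromy X Z = m \<otimes>\<^sub>t ident Z"
  shows "monodromy X (Y \<otimes>\<^sub>o Z) \<circ>\<^sub>t assoc X Y Z =
    assoc X Y Z \<circ>\<^sub>t (((m \<otimes>\<^sub>t ident Y) \<circ>\<^sub>t monodromy X Y) \<otimes>\<^sub>t ident Z)"
proof (rule iso_cancel_left[where f = "inverse_arr (assoc X Y Z)"])
  have "(ident Y \<otimes>\<^sub>t (m \<otimes>\<^sub>t ident Z)) \<circ>\<^sub>t assoc Y X Z =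
      assoc Y X Z \<circ>\<^sub>t ((ident Y \<otimes>\<^sub>t m) \<otimes>\<^sub>t ident Z)"
    by (subst assoc_natural) simp_all
  then have 1: "inverse_arr (assoc Y X Z) \<circ>\<^sub>t (ident Y \<otimes>\<^sub>t (m \<otimes>\<^sub>t ident Z)) \<circ>\<^sub>t assoc Y X Z =
      (ident Y \<otimes>\<^sub>t m) \<otimes>\<^sub>t ident Z"
    by simp
  have 2: "braid Y X \<circ>\<^sub>t (ident Y \<otimes>\<^sub>t m) \<circ>\<^sub>t braid X Y = (m \<otimes>\<^sub>t ident Y) \<circ>\<^sub>t monodromy X Y"
  proof -
    have "braid Y X \<circ>\<^sub>t (ident Y \<otimes>\<^sub>t m) \<circ>\<^sub>t braid X Y =
        (braid Y X \<circ>\<^sub>t (ident Y \<otimes>\<^sub>t m)) \<circ>\<^sub>t braid X Y"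
      by simp
    also have "\<dots> = (m \<otimes>\<^sub>t ident Y) \<circ>\<^sub>t monodromy X Y"
      by (subst braid_natural) (simp_all add: monodromy_def)
    finally show ?thesis .
  qed
  have "inverse_arr (assoc X Y Z) \<circ>\<^sub>t monodromy X (Y \<otimes>\<^sub>o Z) \<circ>\<^sub>t assoc X Y Z =
      (braid Y X \<circ>\<^sub>t (ident Y \<otimes>\<^sub>t m) \<circ>\<^sub>t braid X Y) \<otimes>\<^sub>t ident Z"
    by (simp add: monodromy_TObj Z 1)
  then show "inverse_arr (assoc X Y Z) \<circ>\<^sub>t monodromy X (Y \<otimes>\<^sub>o Z) \<circ>\<^sub>t assoc X Y Z =
      inverse_arr (assoc X Y Z) \<circ>\<^sub>t assoc X Y Z \<circ>\<^sub>t
          (((m \<otimes>\<^sub>t ident Y) \<circ>\<^sub>t monodromy X Y) \<otimes>\<^sub>t ident Z)"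
    unfolding 2 by simp
qed simp_all

lemma monodromy_action_TObj:
  assumes [simp]: "X \<in> Obj C" "Y \<in> Obj C" "Z \<in> Obj C"
      "arr n" "Dom n = X" "Cod n = X" "arr m" "Dom m = X" "Cod m = X"
    and Y: "monodromy X Y = n \<otimes>\<^sub>t ident Y" and Z: "monodromy X Z = m \<otimes>\<^sub>t ident Z"
  shows "monodromy X (Y \<otimes>\<^sub>o Z) = (m \<circ>\<^sub>t n) \<otimes>\<^sub>t ident (Y \<otimes>\<^sub>o Z)"
proof (rule iso_cancel_right[where f = "assoc X Y Z"])
  have "monodromy X (Y \<otimes>\<^sub>o Z) \<circ>\<^sub>t assoc X Y Z =
      assoc X Y Z \<circ>\<^sub>t (((m \<circ>\<^sub>t n) \<otimes>\<^sub>t ident Y) \<otimes>\<^sub>t ident Z)"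
    by (simp add: monodromy_TObj_left_action[where m = m] Z) (simp add: Y)
  also have "\<dots> = ((m \<circ>\<^sub>t n) \<otimes>\<^sub>t (ident Y \<otimes>\<^sub>t ident Z)) \<circ>\<^sub>t assoc X Y Z"
    by (subst assoc_natural) simp_all
  finally show
      "monodromy X (Y \<otimes>\<^sub>o Z) \<circ>\<^sub>t assoc X Y Z = ((m \<circ>\<^sub>t n) \<otimes>\<^sub>t ident (Y \<otimes>\<^sub>o Z)) \<circ>\<^sub>t assoc X Y Z"
    by simp
qed simp_all

text \<open>
  Every endomorphism of \<open>X \<otimes> 1\<close> has the form \<open>n \<otimes> 1\<close>. The double braiding with \<open>1 \<otimes> 1\<close> is then
  \<open>n\<^sup>2 \<otimes> 1\<close> by multiplicativity and \<open>n \<otimes> 1\<close> by naturality, so the invertible \<open>n\<close> is idempotent.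
\<close>

lemma monodromy_Unit:
  assumes [simp]: "X \<in> Obj C"
  shows "monodromy X (Unit C) = ident (X \<otimes>\<^sub>o Unit C)"
proof -
  let ?I = "Unit C"
  define n where "n = runit X \<circ>\<^sub>t monodromy X ?I \<circ>\<^sub>t inverse_arr (runit X)"
  have [simp]: "iso_arr n" "arr n" "Dom n = X" "Cod n = X"
    by (simp_all add: n_def)
  have n: "monodromy X ?I = n \<otimes>\<^sub>t ident ?I"
  proof (rule iso_cancel_left[where f = "runit X"])
    show "runit X \<circ>\<^sub>t monodromy X ?I = runit X \<circ>\<^sub>t (n \<otimes>\<^sub>t ident ?I)"
      by (simp add: runit_natural) (simp add: n_def)
  qed simp_all
  have "(n \<otimes>\<^sub>t ident ?I) \<circ>\<^sub>t (ident X \<otimes>\<^sub>t lunit ?I) =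
      (ident X \<otimes>\<^sub>t lunit ?I) \<circ>\<^sub>t ((n \<circ>\<^sub>t n) \<otimes>\<^sub>t ident (?I \<otimes>\<^sub>o ?I))"
    using monodromy_natural[of "ident X" "lunit ?I" X ?I]
    by (simp add: monodromy_action_TObj[where n = n and m = n] n del: interchange)
  then have
      "(n \<otimes>\<^sub>t ident ?I) \<circ>\<^sub>t (ident X \<otimes>\<^sub>t lunit ?I) =
          ((n \<circ>\<^sub>t n) \<otimes>\<^sub>t ident ?I) \<circ>\<^sub>t (ident X \<otimes>\<^sub>t lunit ?I)"
    by simp
  then have "n \<otimes>\<^sub>t ident ?I = (n \<circ>\<^sub>t n) \<otimes>\<^sub>t ident ?I"
    by (rule iso_cancel_right) simp_all
  then have "n \<circ>\<^sub>t ident X = n \<circ>\<^sub>t n"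
    by (simp add: tens_ident_Unit_cancel)
  then have "ident X = n"
    by (rule iso_cancel_left) simp_all
  then show ?thesis
    using n by (simp flip: \<open>ident X = n\<close>)
qed

text \<open>
  By naturality along the evaluation, \<open>Y\<^sup>* \<otimes> Y\<close> is seen by \<open>X\<close> as the unit object. If \<open>X\<close> sees
  \<open>Y\<close> through \<open>n\<close>, it must therefore see \<open>Y\<^sup>*\<close> through the inverse of \<open>n\<close>.
\<close>

lemma monodromy_action_Dual:
  assumes [simp]: "X \<in> Obj C" "Y \<in> Obj C" "arr n" "Dom n = X" "Cod n = X" "arr m" "Dom m = X"
      "Cod m = X"
    and Y: "monodromy X Y = n \<otimes>\<^sub>t ident Y" and mn: "m \<circ>\<^sub>t n = ident X"
  shows "monodromy X (Dual C Y) = m \<otimes>\<^sub>t ident (Dual C Y)"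
proof -
  let ?Y = "Dual C Y" and ?M = "monodromy X (Dual C Y)"
  have "(n \<otimes>\<^sub>t ident ?Y) \<circ>\<^sub>t ?M = ident (X \<otimes>\<^sub>o ?Y)"
  proof (rule transpose_injective[OF Dual_is_left_dual])
    have "(ident X \<otimes>\<^sub>t ev Y) \<circ>\<^sub>t assoc X ?Y Y \<circ>\<^sub>t (((n \<otimes>\<^sub>t ident ?Y) \<circ>\<^sub>t ?M) \<otimes>\<^sub>t ident Y) =
        ((ident X \<otimes>\<^sub>t ev Y) \<circ>\<^sub>t monodromy X (?Y \<otimes>\<^sub>o Y)) \<circ>\<^sub>t assoc X ?Y Y"
      by (simp add: monodromy_TObj_left_action[where m = n] Y)
    also have "(ident X \<otimes>\<^sub>t ev Y) \<circ>\<^sub>t monodromy X (?Y \<otimes>\<^sub>o Y) = ident X \<otimes>\<^sub>t ev Y"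
      using monodromy_natural[of "ident X" "ev Y" X "Unit C"] by (simp add: monodromy_Unit)
    finally show "(ident X \<otimes>\<^sub>t Arrow (?Y \<otimes>\<^sub>o Y) (Ev C Y) (Unit C)) \<circ>\<^sub>t assoc X ?Y Y \<circ>\<^sub>t
          (((n \<otimes>\<^sub>t ident ?Y) \<circ>\<^sub>t ?M) \<otimes>\<^sub>t ident Y) =
        (ident X \<otimes>\<^sub>t Arrow (?Y \<otimes>\<^sub>o Y) (Ev C Y) (Unit C)) \<circ>\<^sub>t assoc X ?Y Y \<circ>\<^sub>t
            (ident (X \<otimes>\<^sub>o ?Y) \<otimes>\<^sub>t ident Y)"
      by (simp flip: ev_def)
  qed simp_all
  then have "(m \<otimes>\<^sub>t ident ?Y) \<circ>\<^sub>t (n \<otimes>\<^sub>t ident ?Y) \<circ>\<^sub>t ?M = m \<otimes>\<^sub>t ident ?Y"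
    by simp
  then show ?thesis
    by (simp add: mn)
qed

lemma monodromy_sym:
  assumes "monodromy X Y = ident (X \<otimes>\<^sub>o Y)" and [simp]: "X \<in> Obj C" "Y \<in> Obj C"
  shows "monodromy Y X = ident (Y \<otimes>\<^sub>o X)"
proof (rule iso_cancel_right[where f = "braid X Y"])
  have "monodromy Y X \<circ>\<^sub>t braid X Y = braid X Y \<circ>\<^sub>t monodromy X Y"
    by (simp add: monodromy_def)
  then show "monodromy Y X \<circ>\<^sub>t braid X Y = ident (Y \<otimes>\<^sub>o X) \<circ>\<^sub>t braid X Y"
    using assms(1) by simp
qed simp_all

text \<open>
  If the double braiding around \<open>Y \<otimes> Z\<close> is trivial, going around \<open>Y\<close> is undone by going around
  \<open>Z\<close>. So the double braiding with \<open>Y\<close> can be replaced by an arrow that only involves \<open>X\<close> and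
  \<open>Z\<close>.
\<close>

lemma slides_monodromy:
  assumes [simp]: "X \<in> Obj C" "Y \<in> Obj C" "Z \<in> Obj C"
    and XYZ: "monodromy X (Y \<otimes>\<^sub>o Z) = ident (X \<otimes>\<^sub>o Y \<otimes>\<^sub>o Z)"
  shows "slides (monodromy Y X) Y X Z"
proof -
  let ?T = "inverse_arr (assoc Y X Z) \<circ>\<^sub>t (ident Y \<otimes>\<^sub>t monodromy X Z) \<circ>\<^sub>t assoc Y X Z"
  let ?b = "braid Y X \<otimes>\<^sub>t ident Z" and ?b' = "braid X Y \<otimes>\<^sub>t ident Z"
  have "?b \<circ>\<^sub>t ?T \<circ>\<^sub>t ?b' = ident ((X \<otimes>\<^sub>o Y) \<otimes>\<^sub>o Z)"
    using monodromy_TObj[of X Y Z] XYZ by simp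
  then have "(?b \<circ>\<^sub>t ?T \<circ>\<^sub>t ?b') \<circ>\<^sub>t ?b = ?b \<circ>\<^sub>t ident ((Y \<otimes>\<^sub>o X) \<otimes>\<^sub>o Z)"
    by simp
  then have "?b \<circ>\<^sub>t ?T \<circ>\<^sub>t ?b' \<circ>\<^sub>t ?b = ?b \<circ>\<^sub>t ident ((Y \<otimes>\<^sub>o X) \<otimes>\<^sub>o Z)"
    by (simp del: interchange interchange_comp)
  then have "?T \<circ>\<^sub>t ?b' \<circ>\<^sub>t ?b = ident ((Y \<otimes>\<^sub>o X) \<otimes>\<^sub>o Z)"
    by (rule iso_cancel_left) simp_all
  then have T: "?T \<circ>\<^sub>t (monodromy Y X \<otimes>\<^sub>t ident Z) = ident ((Y \<otimes>\<^sub>o X) \<otimes>\<^sub>o Z)"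
    by (simp add: monodromy_def)
  have "assoc Y X Z \<circ>\<^sub>t (monodromy Y X \<otimes>\<^sub>t ident Z) =
      (ident Y \<otimes>\<^sub>t inverse_arr (monodromy X Z)) \<circ>\<^sub>t assoc Y X Z \<circ>\<^sub>t
        ?T \<circ>\<^sub>t (monodromy Y X \<otimes>\<^sub>t ident Z)"
    by simp
  also have "\<dots> = (ident Y \<otimes>\<^sub>t inverse_arr (monodromy X Z)) \<circ>\<^sub>t assoc Y X Z"
    unfolding T by simp
  finally show ?thesis
    unfolding slides_def by (intro exI[of _ "inverse_arr (monodromy X Z)"]) simp
qed

text \<open>
  The exchange that drives the theorem. The double braiding of \<open>Y\<close> and \<open>X\<close> slides past \<open>Y\<^sup>*\<close> by
  \<open>slides_monodromy\<close>, hence past \<open>Y\<^sup>* \<otimes> Y\<close>, hence past its direct summand \<open>1\<close>, which is split off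
  by \<open>s\<close>. So it is a scalar \<open>b\<close>. The dual of \<open>X\<close> contributes \<open>1 / b\<close>, and on \<open>X \<otimes> X\<^sup>*\<close> the two
  scalars cancel.
\<close>

lemma monodromy_adjoint:
  assumes [simp]: "X \<in> Obj C" "Y \<in> Obj C"
    and schur: "\<And>f. f \<in> Hom C X X \<Longrightarrow> \<exists>a. f = Scale C a (Id C X)"
    and s: "arr s" "Dom s = Unit C" "Cod s = Dual C Y \<otimes>\<^sub>o Y" "ev Y \<circ>\<^sub>t s = ident (Unit C)"
    and XY: "monodromy X (Y \<otimes>\<^sub>o Dual C Y) = ident (X \<otimes>\<^sub>o Y \<otimes>\<^sub>o Dual C Y)"
  shows "monodromy (X \<otimes>\<^sub>o Dual C X) Y = ident ((X \<otimes>\<^sub>o Dual C X) \<otimes>\<^sub>o Y)"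
proof -
  let ?M = "monodromy Y X"
  have "slides ?M Y X (Dual C Y)"
    by (rule slides_monodromy) (simp_all add: XY)
  then have "slides ?M Y X (Dual C Y \<otimes>\<^sub>o Y)"
    by (rule slides_tens) simp_all
  then have "slides ?M Y X (Unit C)"
    by (rule slides_retract[where r = "ev Y" and s = s]) (simp_all add: s)
  then obtain a where "?M = scalar a (Y \<otimes>\<^sub>o X)"
    using slides_Unit_scalar[of ?M Y X] schur by auto
  moreover have "iso_arr ?M"
    by simp
  ultimately obtain b where b: "b \<noteq> 0" "?M = scalar b (Y \<otimes>\<^sub>o X)"
    using iso_scalar_nonzero by metis
  then have X: "?M = scalar b Y \<otimes>\<^sub>t ident X"
    by (simp add: scalar_tens_ident)
  then have X': "monodromy Y (Dual C X) = scalar (1 / b) Y \<otimes>\<^sub>t ident (Dual C X)"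
    by (rule monodromy_action_Dual[rotated -2]) (use b in \<open>simp_all add: scalar_1\<close>)
  have "monodromy Y (X \<otimes>\<^sub>o Dual C X) =
      (scalar (1 / b) Y \<circ>\<^sub>t scalar b Y) \<otimes>\<^sub>t ident (X \<otimes>\<^sub>o Dual C X)"
    by (rule monodromy_action_TObj[OF _ _ _ _ _ _ _ _ _ X X']) simp_all
  then have "monodromy Y (X \<otimes>\<^sub>o Dual C X) = ident (Y \<otimes>\<^sub>o X \<otimes>\<^sub>o Dual C X)"
    using b by (simp add: scalar_1)
  then show ?thesis
    by (rule monodromy_sym) simp_all
qed

end


section \<open>Schur's lemma\<close>

context linear_category
begin

lemma zero_in_Hom [simp]: "\<lbrakk>X \<in> Obj C; Y \<in> Obj C\<rbrakk> \<Longrightarrow> 0 \<in> Hom C X Y"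
  by (rule subspace_0[OF Hom_subspace])

lemma Comp_zero:
  assumes "X \<in> Obj C" "Y \<in> Obj C" "Z \<in> Obj C" "g \<in> Hom C Y Z"
  shows "g \<cdot> 0 = 0"
  using Comp_add_right[of X Y Z 0 0 g] assms by simp

lemma zero_Comp:
  assumes "X \<in> Obj C" "Y \<in> Obj C" "Z \<in> Obj C" "f \<in> Hom C X Y"
  shows "0 \<cdot> f = 0"
  using Comp_add_left[of X Y Z f 0 0] assms by simp

lemma Comp_diff_right:
  assumes "X \<in> Obj C" "Y \<in> Obj C" "Z \<in> Obj C" "f \<in> Hom C X Y" "h \<in> Hom C X Y" "g \<in> Hom C Y Z"
  shows "g \<cdot> (f - h) = g \<cdot> f - g \<cdot> h"
  using Comp_add_right[of X Y Z "f - h" h g] assms subspace_diff[OF Hom_subspace, of X Y f h]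
  by (simp add: algebra_simps)

lemma Comp_sum_right:
  assumes "X \<in> Obj C" "Y \<in> Obj C" "Z \<in> Obj C" "\<And>i. i \<in> I \<Longrightarrow> f i \<in> Hom C X Y" "g \<in> Hom C Y Z"
  shows "g \<cdot> (\<Sum>i\<in>I. f i) = (\<Sum>i\<in>I. g \<cdot> f i)"
  using assms
proof (induction I rule: infinite_finite_induct)
  case (insert i I)
  then have "(\<Sum>i\<in>I. f i) \<in> Hom C X Y"
    by (intro subspace_sum Hom_subspace) auto
  with insert show ?case
    by (simp add: Comp_add_right[of X Y Z])
qed (simp_all add: Comp_zero[of X Y Z])

lemma zero_object_iff:
  assumes "X \<in> Obj C"
  shows "zero_object C X \<longleftrightarrow> Id C X = 0"
proof
  assume X: "Id C X = 0"
  have "f = 0" if "Y \<in> Obj C" "f \<in> Hom C X Y" for Y f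
    using Comp_Id[of X Y f] Comp_zero[of X X Y f] X assms that by simp
  moreover have "f = 0" if "Y \<in> Obj C" "f \<in> Hom C Y X" for Y f
    using Id_Comp[of Y X f] zero_Comp[of Y X X f] X assms that by simp
  ultimately show "zero_object C X"
    using assms by (auto simp: zero_object_def)
qed (use assms Id_in_Hom in \<open>auto simp: zero_object_def\<close>)

lemma simple_object_Id: "simple_object C X \<Longrightarrow> Id C X \<noteq> 0"
  by (auto simp: simple_object_def zero_object_iff)

end

context tensor_category
begin

lemma TArr_sum_left:
  assumes "X \<in> Obj C" "X' \<in> Obj C" "Y \<in> Obj C" "Y' \<in> Obj C"
    "\<And>i. i \<in> I \<Longrightarrow> f i \<in> Hom C X X'" "g \<in> Hom C Y Y'"
  shows "(\<Sum>i\<in>I. f i) \<otimes>\<^sub>a g = (\<Sum>i\<in>I. f i \<otimes>\<^sub>a g)"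
proof -
  have zero: "0 \<otimes>\<^sub>a g = 0"
    using TArr_add_left[of X X' Y Y' 0 0 g] assms by simp
  show ?thesis
    using assms
  proof (induction I rule: infinite_finite_induct)
    case (insert i I)
    then have "(\<Sum>i\<in>I. f i) \<in> Hom C X X'"
      by (intro subspace_sum Hom_subspace) auto
    with insert show ?case
      by (simp add: TArr_add_left[of X X' Y Y'])
  qed (simp_all add: zero)
qed

end

context abelian_category
begin

lemma mono_arrowI_zero_kernel:
  assumes [simp]: "X \<in> Obj C" "Y \<in> Obj C" and f: "f \<in> Hom C X Y"
    and K: "K \<in> Obj C" "is_kernel C X Y f K i" and "i = 0"
  shows "mono_arrow C X Y f"
  unfolding mono_arrow_def
proof (intro conjI ballI impI)
  fix W g h
  assume [simp]: "W \<in> Obj C" and g: "g \<in> Hom C W X" and h: "h \<in> Hom C W X" and eq: "f \<cdot> g = f \<cdot> h"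
  have gh: "g - h \<in> Hom C W X"
    by (rule subspace_diff[OF Hom_subspace]) (simp_all add: g h)
  moreover have "f \<cdot> (g - h) = 0"
    using eq by (simp add: Comp_diff_right[of W X Y] f g h)
  ultimately obtain u where "u \<in> Hom C W K" "i \<cdot> u = g - h"
    using K(2) \<open>W \<in> Obj C\<close> unfolding is_kernel_def by blast
  then show "g = h"
    using zero_Comp[of W K X u] K \<open>i = 0\<close> by simp
qed (rule f)

lemma mono_arrow_kernel:
  assumes "X \<in> Obj C" "Y \<in> Obj C" "f \<in> Hom C X Y" "K \<in> Obj C" "is_kernel C X Y f K i"
  shows "mono_arrow C K X i"
  unfolding mono_arrow_def
proof (intro conjI ballI impI)
  show i: "i \<in> Hom C K X"
    using assms by (simp add: is_kernel_def)
  fix W g h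
  assume W: "W \<in> Obj C" "g \<in> Hom C W K" "h \<in> Hom C W K" and eq: "i \<cdot> g = i \<cdot> h"
  have "i \<cdot> g \<in> Hom C W X"
    using Comp_in_Hom[of W K X g i] assms i W by simp
  moreover have "f \<cdot> (i \<cdot> g) = 0"
    using Comp_assoc[of W K X Y g i f] zero_Comp[of W K Y g] assms i W by (simp add: is_kernel_def)
  ultimately show "g = h"
    using assms(5) W eq unfolding is_kernel_def by metis
qed

lemma schur_iso:
  assumes S: "simple_object C S" and T: "simple_object C T" and f: "f \<in> Hom C S T" "f \<noteq> 0"
  shows "iso_arrow C S T f"
proof -
  have [simp]: "S \<in> Obj C" "T \<in> Obj C"
    using S T by (simp_all add: simple_object_def)
  obtain K i where K: "K \<in> Obj C" "is_kernel C S T f K i"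
    using kernel_exists[of S T f] f by auto
  have i: "i \<in> Hom C K S" "f \<cdot> i = 0"
    using K by (simp_all add: is_kernel_def)
  have "mono_arrow C K S i"
    using mono_arrow_kernel[of S T f K i] K f by simp
  then have "zero_object C K \<or> iso_arrow C K S i"
    using S K unfolding simple_object_def by blast
  moreover have "\<not> iso_arrow C K S i"
  proof
    assume "iso_arrow C K S i"
    then obtain j where j: "j \<in> Hom C S K" "i \<cdot> j = Id C S"
      unfolding iso_arrow_def mutually_inverse_def by blast
    have "f = f \<cdot> (i \<cdot> j)"
      using Comp_Id[of S T f] f j by simp
    also have "\<dots> = (f \<cdot> i) \<cdot> j"
      using Comp_assoc[of S K S T j i f] K i f j by simp
    also have "\<dots> = 0"
      using zero_Comp[of S K T j] K i j by simp
    finally show False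
      using f by simp
  qed
  ultimately have "i = 0"
    using i K by (auto simp: zero_object_def)
  then have "mono_arrow C S T f"
    using mono_arrowI_zero_kernel[of S T f K i] K f by simp
  then show ?thesis
    using S T unfolding simple_object_def by blast
qed

end

context semisimple_category
begin

text \<open>
  Since the source is a direct sum of simple objects, a nonzero arrow to a simple object is
  nonzero on some summand, where it is invertible by Schur's lemma.
\<close>

lemma split_epi_onto_simple:
  assumes [simp]: "X \<in> Obj C" and T: "simple_object C T" and f: "f \<in> Hom C X T" "f \<noteq> 0"
  shows "\<exists>s\<in>Hom C T X. f \<cdot> s = Id C T"
proof -
  have [simp]: "T \<in> Obj C"
    using T by (simp add: simple_object_def)
  obtain Ss where Ss: "\<forall>S\<in>set Ss. simple_object C S" "is_direct_sum C Ss X"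
    using semisimple[of X] by auto
  then obtain \<iota> \<pi> where \<iota>: "\<And>i. i < length Ss \<Longrightarrow> \<iota> i \<in> Hom C (Ss ! i) X"
    and \<pi>: "\<And>i. i < length Ss \<Longrightarrow> \<pi> i \<in> Hom C X (Ss ! i)"
    and sum: "(\<Sum>i<length Ss. \<iota> i \<cdot> \<pi> i) = Id C X"
    unfolding is_direct_sum_def by blast
  have S: "simple_object C (Ss ! i)" "Ss ! i \<in> Obj C" if "i < length Ss" for i
    using Ss that by (auto simp: simple_object_def)
  have "\<exists>i<length Ss. f \<cdot> \<iota> i \<noteq> 0"
  proof (rule ccontr)
    assume "\<not> ?thesis"
    then have 0: "f \<cdot> \<iota> i = 0" if "i < length Ss" for i
      using that by blast
    have "f = f \<cdot> (\<Sum>i<length Ss. \<iota> i \<cdot> \<pi> i)"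
      using Comp_Id[of X T f] f sum by simp
    also have "\<dots> = (\<Sum>i<length Ss. f \<cdot> (\<iota> i \<cdot> \<pi> i))"
    proof (rule Comp_sum_right[of X X T])
      show "\<iota> i \<cdot> \<pi> i \<in> Hom C X X" if "i \<in> {..<length Ss}" for i
        using that Comp_in_Hom[of X "Ss ! i" X "\<pi> i" "\<iota> i"] S \<iota> \<pi> by simp
    qed (use f in simp_all)
    also have "\<dots> = 0"
    proof (intro sum.neutral ballI)
      fix i
      assume "i \<in> {..<length Ss}"
      then show "f \<cdot> (\<iota> i \<cdot> \<pi> i) = 0"
        using Comp_assoc[of X "Ss ! i" X T "\<pi> i" "\<iota> i" f] zero_Comp[of X "Ss ! i" T "\<pi> i"] S \<iota> \<pi>
            0 f
        by simp
    qed
    finally show False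
      using f by simp
  qed
  then obtain i where i: "i < length Ss" "f \<cdot> \<iota> i \<noteq> 0"
    by blast
  have "f \<cdot> \<iota> i \<in> Hom C (Ss ! i) T"
    using Comp_in_Hom[of "Ss ! i" X T "\<iota> i" f] S \<iota> f i by simp
  then have "iso_arrow C (Ss ! i) T (f \<cdot> \<iota> i)"
    using schur_iso S T i by blast
  then obtain j where j: "j \<in> Hom C T (Ss ! i)" "(f \<cdot> \<iota> i) \<cdot> j = Id C T"
    unfolding iso_arrow_def mutually_inverse_def by blast
  show ?thesis
  proof
    show "\<iota> i \<cdot> j \<in> Hom C T X"
      using Comp_in_Hom[of T "Ss ! i" X j "\<iota> i"] S \<iota> i j by simp
    show "f \<cdot> \<iota> i \<cdot> j = Id C T"
      using Comp_assoc[of T "Ss ! i" X T j "\<iota> i" f] S \<iota> i j f by simp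
  qed
qed

end

context fusion_category
begin

text \<open>
  Evaluation of a polynomial at the endomorphism \<open>f\<close> of \<open>X\<close>, by the Horner scheme.
\<close>

definition poly_action :: "'m \<Rightarrow> 'o \<Rightarrow> 'k poly \<Rightarrow> 'm" where
  "poly_action f X p = fold_coeffs (\<lambda>a g. Scale C a (Id C X) + f \<cdot> g) p 0"

context
  fixes X f
  assumes X [simp]: "X \<in> Obj C" and f [simp]: "f \<in> Hom C X X"
begin

lemma End_subspace: "subspace (Hom C X X)"
  by (rule Hom_subspace) simp_all

lemma poly_action_0 [simp]: "poly_action f X 0 = 0"
  by (simp add: poly_action_def)

lemma poly_action_pCons: "poly_action f X (pCons a p) = Scale C a (Id C X) + f \<cdot> poly_action f X p"
proof (cases "a = 0 \<and> p = 0")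
  case True
  then show ?thesis
    by (simp add: Comp_zero[of X X X])
next
  case False
  then show ?thesis
    by (auto simp: poly_action_def)
qed

lemma poly_action_in_Hom [simp]: "poly_action f X p \<in> Hom C X X"
proof (induction p)
  case (pCons a p)
  then show ?case
    by (simp add: poly_action_pCons subspace_add[OF End_subspace] subspace_scale[OF End_subspace]
        Comp_in_Hom[of X X X] Id_in_Hom)
qed simp

lemma poly_action_add: "poly_action f X (p + q) = poly_action f X p + poly_action f X q"
proof (induction p q rule: poly_induct2)
  case (pCons a p b q)
  then show ?case
    by (simp add: poly_action_pCons Comp_add_right[of X X X] scale_left_distrib)
qed simp

lemma poly_action_smult: "poly_action f X (smult a p) = Scale C a (poly_action f X p)"
proof (induction p)
  case (pCons b p)
  then show ?case
    by (simp add: poly_action_pCons Comp_scale_right[of X X X] scale_right_distrib)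
qed simp

lemma poly_action_linear_factor:
  "poly_action f X ([:- a, 1:] * q) = (f - Scale C a (Id C X)) \<cdot> poly_action f X q"
proof -
  let ?Q = "poly_action f X q" and ?s = "Scale C a (Id C X)"
  have s: "?s \<in> Hom C X X"
    by (simp add: subspace_scale[OF End_subspace] Id_in_Hom)
  have "[:- a, 1:] * q = pCons 0 q + smult (- a) q"
    by simp
  then have "poly_action f X ([:- a, 1:] * q) = f \<cdot> ?Q - Scale C a ?Q"
    by (simp only: poly_action_add poly_action_smult poly_action_pCons) simp
  moreover have "?s \<cdot> ?Q = Scale C a ?Q"
    by (simp add: Comp_scale_left[of X X X] Id_Comp[of X X] Id_in_Hom)
  moreover have "f \<cdot> ?Q = (f - ?s) \<cdot> ?Q + ?s \<cdot> ?Q"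
    using Comp_add_left[of X X X ?Q "f - ?s" ?s] subspace_diff[OF End_subspace f s] s by simp
  ultimately show ?thesis
    by simp
qed

text \<open>
  The powers of \<open>f\<close> lie in a finite-dimensional space, so some power is a combination of smaller
  ones.
\<close>

lemma annihilating_poly: "\<exists>p. p \<noteq> 0 \<and> poly_action f X p = 0"
proof -
  let ?x = "\<lambda>n. poly_action f X (monom 1 n)"
  obtain B where B: "finite B" "span B = Hom C X X"
    using Hom_finite_dimensional[of X X] by auto
  have "\<exists>n. ?x n \<in> span (?x ` {..<n})"
  proof (rule ccontr)
    assume *: "\<not> ?thesis"
    have "independent (?x ` {..<n}) \<and> card (?x ` {..<n}) = n" for n
    proof (induction n)
      case 0
      show ?case
        by (simp add: independent_empty)
    next
      case (Suc n)
      have "?x n \<notin> span (?x ` {..<n})" "?x n \<notin> ?x ` {..<n}"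
        using * span_base[of "?x n" "?x ` {..<n}"] by blast+
      with Suc show ?case
        unfolding lessThan_Suc image_insert by (simp add: independent_insertI)
    qed
    then have indep: "independent (?x ` {..<Suc (card B)})" and card:
        "card (?x ` {..<Suc (card B)}) = Suc (card B)"
      by blast+
    have "?x ` {..<Suc (card B)} \<subseteq> span B"
      unfolding B(2) by (rule image_subsetI) simp
    from independent_span_bound[OF B(1) indep this] card show False
      by simp
  qed
  then obtain n where n: "?x n \<in> span (?x ` {..<n})" ..
  \<comment> \<open>The condition on the coefficient of degree \<open>n\<close> ensures that subtracting \<open>q\<close> from the
  monomial of degree \<open>n\<close> leaves a nonzero polynomial.\<close>
  have "\<exists>q. coeff q n = 0 \<and> v = poly_action f X q" if "v \<in> span (?x ` {..<n})" for v
    using that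
  proof (induction rule: span_induct_alt)
    case base
    show ?case
      by (intro exI[of _ 0]) simp
  next
    case (step a v w)
    from step(1) obtain i where "i < n" "v = ?x i"
      by blast
    moreover from step.IH obtain q where "coeff q n = 0" "w = poly_action f X q"
      by blast
    ultimately show ?case
      by (intro exI[of _ "smult a (monom 1 i) + q"])
          (simp only: poly_action_add poly_action_smult, simp)
  qed
  then obtain q where q: "coeff q n = 0" "?x n = poly_action f X q"
    using n by blast
  let ?p = "monom 1 n + smult (- 1) q"
  have "poly_action f X ?p = 0"
    by (simp only: poly_action_add poly_action_smult q(2)) simp
  moreover have "coeff ?p n \<noteq> 0"
    using q(1) by simp
  then have "?p \<noteq> 0"
    by (metis coeff_0)
  ultimately show ?thesis
    by blast
qed

end

text \<open>
  Over an algebraically closed field an annihilating polynomial of \<open>f\<close> splits off a factor \<open>x -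
  a\<close>. Either \<open>f = a\<close>, or \<open>f - a\<close> is invertible by Schur's lemma and can be cancelled, leaving an
  annihilating polynomial of smaller degree.
\<close>

lemma schur_scalar:
  assumes X: "simple_object C X" and f: "f \<in> Hom C X X"
  shows "\<exists>a. f = Scale C a (Id C X)"
proof -
  have [simp]: "X \<in> Obj C"
    using X by (simp add: simple_object_def)
  obtain p where "p \<noteq> 0" "poly_action f X p = 0"
    using annihilating_poly[OF _ f] by auto
  then show ?thesis
  proof (induction "degree p" arbitrary: p rule: less_induct)
    case less
    show ?case
    proof (cases "degree p = 0")
      case True
      then obtain a where a: "p = [:a:]"
        by (rule degree_eq_zeroE)
      have "Scale C a (Id C X) = 0" "a \<noteq> 0"
        using less.prems f unfolding a by (simp_all add: poly_action_pCons Comp_zero[of X X X])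
      then show ?thesis
        using simple_object_Id[OF X] by simp
    next
      case False
      then obtain a where "poly p a = 0"
        using alg_closed_imp_poly_has_root by blast
      then obtain q where q: "p = [:- a, 1:] * q"
        unfolding poly_eq_0_iff_dvd by (rule dvdE)
      let ?g = "f - Scale C a (Id C X)" and ?Q = "poly_action f X q"
      have g: "?g \<in> Hom C X X"
        using f by
            (simp add: subspace_diff[OF End_subspace] subspace_scale[OF End_subspace] Id_in_Hom)
      have Q: "?Q \<in> Hom C X X"
        using f by simp
      have gQ: "?g \<cdot> ?Q = 0"
        using less.prems(2) f unfolding q by (simp only: poly_action_linear_factor \<open>X \<in> Obj C\<close>)
      show ?thesis
      proof (cases "?g = 0")
        case True
        then have "f = Scale C a (Id C X)"
          by simp
        then show ?thesis ..
      next
        case False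
        then obtain h where h: "h \<in> Hom C X X" "h \<cdot> ?g = Id C X"
          using schur_iso[OF X X g] unfolding iso_arrow_def mutually_inverse_def by blast
        have "?Q = (h \<cdot> ?g) \<cdot> ?Q"
          unfolding h(2) using Id_Comp[of X X ?Q] Q by simp
        also have "\<dots> = h \<cdot> (?g \<cdot> ?Q)"
          by (rule Comp_assoc[of X X X X]) (simp_all add: g h Q)
        also have "\<dots> = 0"
          unfolding gQ using h(1) by (simp add: Comp_zero[of X X X])
        finally have "?Q = 0" .
        moreover have "q \<noteq> 0"
          using less.prems(1) unfolding q by auto
        moreover have "degree q < degree p"
          unfolding q using \<open>q \<noteq> 0\<close> by (subst degree_mult_eq) simp_all
        ultimately show ?thesis
          using less.hyps by blast
      qed
    qed
  qed
qed

end


section \<open>Centralizers\<close>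

context braided_fusion_category
begin

definition centralizer :: "'o set \<Rightarrow> 'o set" where
  "centralizer E = {X \<in> Obj C. \<forall>Y\<in>E. double_braiding C X Y = Id C (X \<otimes>\<^sub>o Y)}"

lemma centralizer_monodromy:
  "centralizer E = {X \<in> Obj C. \<forall>Y\<in>E. monodromy X Y = ident (X \<otimes>\<^sub>o Y)}"
  by (simp add: centralizer_def monodromy_eq_ident_iff)

text \<open>
  By naturality the double braiding agrees with the identity on each summand, and the summands of
  \<open>P\<close> exhaust \<open>P \<otimes> Y\<close>.
\<close>

lemma monodromy_direct_sum:
  assumes Xs: "set Xs \<subseteq> Obj C" and P: "is_direct_sum C Xs P" and [simp]: "P \<in> Obj C" "Y \<in> Obj C"
    and X: "\<And>X. X \<in> set Xs \<Longrightarrow> monodromy X Y = ident (X \<otimes>\<^sub>o Y)"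
  shows "monodromy P Y = ident (P \<otimes>\<^sub>o Y)"
proof -
  obtain \<iota> \<pi> where \<iota>: "\<And>i. i < length Xs \<Longrightarrow> \<iota> i \<in> Hom C (Xs ! i) P"
    and \<pi>: "\<And>i. i < length Xs \<Longrightarrow> \<pi> i \<in> Hom C P (Xs ! i)"
    and sum: "(\<Sum>i<length Xs. \<iota> i \<cdot> \<pi> i) = Id C P"
    using P unfolding is_direct_sum_def by blast
  let ?e = "\<lambda>i. \<iota> i \<cdot> \<pi> i" and ?M = "Map (monodromy P Y)"
  have Xi [simp]: "Xs ! i \<in> Obj C" "Xs ! i \<in> set Xs" if "i < length Xs" for i
    using that Xs by auto
  have e: "?e i \<in> Hom C P P" if "i < length Xs" for i
    using that Comp_in_Hom[of P "Xs ! i" P "\<pi> i" "\<iota> i"] \<iota> \<pi> by simp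
  have eY: "?e i \<otimes>\<^sub>a Id C Y \<in> Hom C (P \<otimes>\<^sub>o Y) (P \<otimes>\<^sub>o Y)" if "i < length Xs" for i
    using TArr_in_Hom[OF _ _ _ _ e[OF that] Id_in_Hom] by simp
  have "arr (monodromy P Y)"
    by simp
  then have M: "?M \<in> Hom C (P \<otimes>\<^sub>o Y) (P \<otimes>\<^sub>o Y)"
    unfolding arr_def by simp
  have Me: "?M \<cdot> (?e i \<otimes>\<^sub>a Id C Y) = ?e i \<otimes>\<^sub>a Id C Y" if i: "i < length Xs" for i
  proof -
    let ?i = "Arrow (Xs ! i) (\<iota> i) P" and ?p = "Arrow P (\<pi> i) (Xs ! i)"
    have [simp]: "\<iota> i \<in> Hom C (Xs ! i) P" "\<pi> i \<in> Hom C P (Xs ! i)"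
      using i \<iota> \<pi> by simp_all
    have "monodromy P Y \<circ>\<^sub>t (?i \<otimes>\<^sub>t ident Y) = ?i \<otimes>\<^sub>t ident Y"
      using monodromy_natural[of ?i "ident Y" P Y] i by (simp add: X)
    then have
        "(monodromy P Y \<circ>\<^sub>t (?i \<otimes>\<^sub>t ident Y)) \<circ>\<^sub>t (?p \<otimes>\<^sub>t ident Y) =
            (?i \<otimes>\<^sub>t ident Y) \<circ>\<^sub>t (?p \<otimes>\<^sub>t ident Y)"
      by (rule arg_cong)
    then have "monodromy P Y \<circ>\<^sub>t ((?i \<circ>\<^sub>t ?p) \<otimes>\<^sub>t ident Y) = (?i \<circ>\<^sub>t ?p) \<otimes>\<^sub>t ident Y"
      using i by simp
    then show ?thesis
      by (simp add: compose_def tens_def ident_def)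
  qed
  have "Id C (P \<otimes>\<^sub>o Y) = (\<Sum>i<length Xs. ?e i) \<otimes>\<^sub>a Id C Y"
    by (simp add: sum TArr_Id)
  also have "\<dots> = (\<Sum>i<length Xs. ?e i \<otimes>\<^sub>a Id C Y)"
    by (rule TArr_sum_left[of P P Y Y]) (simp_all add: e Id_in_Hom)
  finally have "?M \<cdot> Id C (P \<otimes>\<^sub>o Y) = ?M \<cdot> (\<Sum>i<length Xs. ?e i \<otimes>\<^sub>a Id C Y)"
    by (rule arg_cong)
  also have "\<dots> = (\<Sum>i<length Xs. ?M \<cdot> (?e i \<otimes>\<^sub>a Id C Y))"
    by (rule Comp_sum_right[of "P \<otimes>\<^sub>o Y" "P \<otimes>\<^sub>o Y" "P \<otimes>\<^sub>o Y"]) (simp_all add: eY M)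
  also have "\<dots> = (\<Sum>i<length Xs. ?e i \<otimes>\<^sub>a Id C Y)"
    by (simp add: Me)
  also have "\<dots> = Id C (P \<otimes>\<^sub>o Y)"
    using \<open>Id C (P \<otimes>\<^sub>o Y) = (\<Sum>i<length Xs. ?e i) \<otimes>\<^sub>a Id C Y\<close>
      \<open>(\<Sum>i<length Xs. ?e i) \<otimes>\<^sub>a Id C Y = (\<Sum>i<length Xs. ?e i \<otimes>\<^sub>a Id C Y)\<close> by simp
  finally have "?M = Id C (P \<otimes>\<^sub>o Y)"
    using Comp_Id[of "P \<otimes>\<^sub>o Y" "P \<otimes>\<^sub>o Y" ?M] M by simp
  then show ?thesis
    by (intro arrow.expand) (simp_all add: ident_def)
qed

lemma monodromy_subobject:
  assumes "subobject C Z X" and [simp]: "X \<in> Obj C" "Y \<in> Obj C" "Z \<in> Obj C"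
    and X: "monodromy X Y = ident (X \<otimes>\<^sub>o Y)"
  shows "monodromy Z Y = ident (Z \<otimes>\<^sub>o Y)"
proof -
  obtain f where f: "mono_arrow C Z X f"
    using assms(1) by (auto simp: subobject_def)
  let ?f = "Arrow Z f X"
  have [simp]: "f \<in> Hom C Z X"
    using f unfolding mono_arrow_def by blast
  have "mono_arr (?f \<otimes>\<^sub>t ident Y)"
    by (intro mono_tens_ident mono_arr_Arrow f) simp_all
  moreover have "(?f \<otimes>\<^sub>t ident Y) \<circ>\<^sub>t monodromy Z Y = (?f \<otimes>\<^sub>t ident Y) \<circ>\<^sub>t ident (Z \<otimes>\<^sub>o Y)"
    using monodromy_natural[of ?f "ident Y" X Y] by (simp add: X)
  ultimately show ?thesis
    by (rule mono_arrD) simp_all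
qed

text \<open>
  Closure under tensor products and duals is the case \<open>n = m = 1\<close> of \<open>monodromy_action_TObj\<close> and
  \<open>monodromy_action_Dual\<close>. These concern the second argument of the double braiding; being
  trivial is a symmetric condition.
\<close>

lemma centralizer_fusion:
  assumes E: "E \<subseteq> Obj C"
  shows "is_fusion_subcategory C (centralizer E)"
proof -
  have cent: "X \<in> centralizer E \<longleftrightarrow> X \<in> Obj C \<and> (\<forall>Y\<in>E. monodromy X Y = ident (X \<otimes>\<^sub>o Y))" for X
    by (simp add: centralizer_monodromy)
  have cent': "X \<in> centralizer E \<longleftrightarrow> X \<in> Obj C \<and> (\<forall>Y\<in>E. monodromy Y X = ident (Y \<otimes>\<^sub>o X))" for X
    using E monodromy_sym unfolding cent by blast
  have action: "monodromy Y X = ident Y \<otimes>\<^sub>t ident X" if "X \<in> centralizer E" "Y \<in> E" for X Y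
    using that E by (auto simp: cent')
  show ?thesis
    unfolding is_fusion_subcategory_def
  proof (intro conjI ballI allI impI)
    show "centralizer E \<subseteq> Obj C"
      by (auto simp: cent)
    show "Unit C \<in> centralizer E"
      using E by (auto simp: cent' intro!: monodromy_Unit)
    show "X \<otimes>\<^sub>o Z \<in> centralizer E" if X: "X \<in> centralizer E" and Z: "Z \<in> centralizer E" for X Z
      unfolding cent'
    proof (intro conjI ballI)
      show "X \<otimes>\<^sub>o Z \<in> Obj C"
        using X Z by (simp add: cent)
      fix Y
      assume Y: "Y \<in> E"
      have "monodromy Y (X \<otimes>\<^sub>o Z) = (ident Y \<circ>\<^sub>t ident Y) \<otimes>\<^sub>t ident (X \<otimes>\<^sub>o Z)"
        using X Z Y E by (intro monodromy_action_TObj action) (auto simp: cent)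
      then show "monodromy Y (X \<otimes>\<^sub>o Z) = ident (Y \<otimes>\<^sub>o X \<otimes>\<^sub>o Z)"
        using X Z Y E by (auto simp: cent)
    qed
    show "Dual C X \<in> centralizer E" if X: "X \<in> centralizer E" for X
      unfolding cent'
    proof (intro conjI ballI)
      show "Dual C X \<in> Obj C"
        using X by (simp add: cent)
      fix Y
      assume Y: "Y \<in> E"
      have "monodromy Y (Dual C X) = ident Y \<otimes>\<^sub>t ident (Dual C X)"
        using X Y E by (intro monodromy_action_Dual[where n = "ident Y"] action) (auto simp: cent)
      then show "monodromy Y (Dual C X) = ident (Y \<otimes>\<^sub>o Dual C X)"
        using X Y E by (auto simp: cent)
    qed
    show "P \<in> centralizer E" if "P \<in> Obj C" "set Xs \<subseteq> centralizer E \<and> is_direct_sum C Xs P" for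
        Xs P
      using that E unfolding cent by (auto simp: cent intro!: monodromy_direct_sum[of Xs P])
    show "Z \<in> centralizer E" if "X \<in> centralizer E" "Z \<in> Obj C" "subobject C Z X" for X Z
      using that E monodromy_subobject[of Z X] unfolding cent by blast
  qed
qed

end


section \<open>Fusion subcategories of fusion subcategories\<close>

lemma full_subcategory_sel [simp]:
  "Obj (full_subcategory C D) = D"
  "Hom (full_subcategory C D) = Hom C"
  "Id (full_subcategory C D) = Id C"
  "Comp (full_subcategory C D) = Comp C"
  by (simp_all add: full_subcategory_def)

lemma full_subcategory_monoidal_sel [simp]:
  "Unit (full_subcategory C D) = Unit C"
  "TObj (full_subcategory C D) = TObj C"
  by (simp_all add: full_subcategory_def)

lemma full_subcategory_Dual [simp]: "Dual (full_subcategory C D) = Dual C"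
  by (simp add: full_subcategory_def)

lemma full_subcategory_full_subcategory [simp]:
  "full_subcategory (full_subcategory C D) E = full_subcategory C E"
  by (simp add: full_subcategory_def)

lemma full_subcategory_Obj [simp]: "full_subcategory C (Obj C) = C"
  by (simp add: full_subcategory_def)

lemma is_direct_sum_full [simp]: "is_direct_sum (full_subcategory C D) Xs P = is_direct_sum C Xs P"
  by (simp add: is_direct_sum_def)

lemma mutually_inverse_full [simp]:
  "mutually_inverse (full_subcategory C D) X Y f g = mutually_inverse C X Y f g"
  by (simp add: mutually_inverse_def)

lemma iso_arrow_full [simp]: "iso_arrow (full_subcategory C D) X Y f = iso_arrow C X Y f"
  by (simp add: iso_arrow_def)

lemma is_fusion_subcategoryD:
  assumes "is_fusion_subcategory C D"
  shows "D \<subseteq> Obj C" and "Unit C \<in> D"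
    and "\<lbrakk>X \<in> D; Y \<in> D\<rbrakk> \<Longrightarrow> X \<otimes>\<^sub>o\<^bsub>C\<^esub> Y \<in> D"
    and "X \<in> D \<Longrightarrow> Dual C X \<in> D"
    and "\<lbrakk>P \<in> Obj C; set Xs \<subseteq> D; is_direct_sum C Xs P\<rbrakk> \<Longrightarrow> P \<in> D"
    and "\<lbrakk>X \<in> D; Y \<in> Obj C; subobject C Y X\<rbrakk> \<Longrightarrow> Y \<in> D"
  using assms unfolding is_fusion_subcategory_def by simp_all

lemma is_fusion_subcategory_Inter:
  assumes "F \<noteq> {}" and F: "\<And>D. D \<in> F \<Longrightarrow> is_fusion_subcategory C D"
  shows "is_fusion_subcategory C (\<Inter>F)"
  unfolding is_fusion_subcategory_def
proof (intro conjI ballI allI impI InterI)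
  show "\<Inter>F \<subseteq> Obj C"
    using assms(1) is_fusion_subcategoryD(1)[OF F] by blast
next
  fix D assume "D \<in> F"
  note D = is_fusion_subcategoryD[OF F[OF this]]
  show "Unit C \<in> D"
    by (rule D)
  show "X \<otimes>\<^sub>o\<^bsub>C\<^esub> Y \<in> D" if "X \<in> \<Inter>F" "Y \<in> \<Inter>F" for X Y
    using that \<open>D \<in> F\<close> by (intro D(3)) auto
  show "Dual C X \<in> D" if "X \<in> \<Inter>F" for X
    using that \<open>D \<in> F\<close> by (intro D(4)) auto
  show "P \<in> D" if "P \<in> Obj C" "set Xs \<subseteq> \<Inter>F \<and> is_direct_sum C Xs P" for Xs P
    using that \<open>D \<in> F\<close> by (intro D(5)[of P Xs]) auto
  show "Y \<in> D" if "X \<in> \<Inter>F" "Y \<in> Obj C" "subobject C Y X" for X Y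
    using that \<open>D \<in> F\<close> by (intro D(6)[of X Y]) auto
qed

context fusion_category
begin

lemma subobject_split:
  assumes "X \<in> Obj C" "Z \<in> Obj C" and i: "i \<in> Hom C Z X" and p: "p \<in> Hom C X Z" and pi:
      "p \<cdot> i = Id C Z"
  shows "subobject C Z X"
proof -
  have "g = h" if W: "W \<in> Obj C" "g \<in> Hom C W Z" "h \<in> Hom C W Z" and eq: "i \<cdot> g = i \<cdot> h" for W g h
  proof -
    have "p \<cdot> (i \<cdot> k) = k" if "k \<in> Hom C W Z" for k
      using Comp_assoc[of W Z X Z k i p] Id_Comp[of W Z k] assms W that by simp
    then show ?thesis
      using W eq by metis
  qed
  then show ?thesis
    using i unfolding subobject_def mono_arrow_def by blast
qed

lemma is_fusion_subcategory_Obj: "is_fusion_subcategory C (Obj C)"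
  by (simp add: is_fusion_subcategory_def Dual_in_Obj)

text \<open>
  Monomorphisms of \<open>D\<close> are tested against fewer arrows. But the kernel in \<open>C\<close> is a subobject,
  hence belongs to \<open>D\<close>, and it suffices to test against the kernel. This is why simple objects,
  subobjects and fusion subcategories of \<open>D\<close> are those of \<open>C\<close> contained in \<open>D\<close>.
\<close>

lemma mono_arrow_full:
  assumes D: "is_fusion_subcategory C D" and X: "X \<in> D" and Y: "Y \<in> D"
  shows "mono_arrow (full_subcategory C D) X Y f \<longleftrightarrow> mono_arrow C X Y f"
proof
  have sub: "D \<subseteq> Obj C"
    using D by (simp add: is_fusion_subcategory_def)
  show "mono_arrow (full_subcategory C D) X Y f" if "mono_arrow C X Y f"
    using that sub unfolding mono_arrow_def full_subcategory_sel by blast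
  assume f: "mono_arrow (full_subcategory C D) X Y f"
  then have fXY: "f \<in> Hom C X Y"
    unfolding mono_arrow_def full_subcategory_sel by blast
  have [simp]: "X \<in> Obj C" "Y \<in> Obj C"
    using X Y sub by auto
  obtain K i where K: "K \<in> Obj C" "is_kernel C X Y f K i"
    using kernel_exists[of X Y f] fXY by auto
  have i: "i \<in> Hom C K X" "f \<cdot> i = 0"
    using K by (simp_all add: is_kernel_def)
  have "subobject C K X"
    using mono_arrow_kernel[of X Y f K i] K fXY by (auto simp: subobject_def)
  then have "K \<in> D"
    using D X K unfolding is_fusion_subcategory_def by blast
  moreover have "f \<cdot> i = f \<cdot> 0" "0 \<in> Hom C K X"
    using i K fXY Comp_zero[of K X Y f] by simp_all
  ultimately have "i = 0"
    using f i(1) unfolding mono_arrow_def full_subcategory_sel by blast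
  then show "mono_arrow C X Y f"
    using mono_arrowI_zero_kernel[of X Y f K i] K fXY by simp
qed

lemma zero_object_full:
  assumes D: "is_fusion_subcategory C D" and X: "X \<in> D"
  shows "zero_object (full_subcategory C D) X \<longleftrightarrow> zero_object C X"
proof -
  have "D \<subseteq> Obj C"
    using D by (simp add: is_fusion_subcategory_def)
  moreover have "Id C X = 0" if "zero_object (full_subcategory C D) X"
    using that X Id_in_Hom[of X] \<open>D \<subseteq> Obj C\<close> by (auto simp: zero_object_def)
  ultimately show ?thesis
    using X zero_object_iff[of X] by (auto simp: zero_object_def)
qed

lemma simple_object_full:
  assumes D: "is_fusion_subcategory C D"
  shows "simple_object (full_subcategory C D) X \<longleftrightarrow> X \<in> D \<and> simple_object C X"
proof (cases "X \<in> D")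
  case True
  note D' = is_fusion_subcategoryD[OF D]
  have "(\<forall>Y\<in>D. \<forall>f. mono_arrow (full_subcategory C D) Y X f \<longrightarrow>
        zero_object (full_subcategory C D) Y \<or> iso_arrow C Y X f) \<longleftrightarrow>
      (\<forall>Y\<in>D. \<forall>f. mono_arrow C Y X f \<longrightarrow> zero_object C Y \<or> iso_arrow C Y X f)"
    by (intro ball_cong refl) (simp add: mono_arrow_full[OF D _ True] zero_object_full[OF D])
  also have "\<dots> \<longleftrightarrow> (\<forall>Y\<in>Obj C. \<forall>f. mono_arrow C Y X f \<longrightarrow> zero_object C Y \<or> iso_arrow C Y X f)"
    using D'(1) D'(6)[OF True] unfolding subobject_def by blast
  finally show ?thesis
    using True D'(1) zero_object_full[OF D True] by (simp add: simple_object_def subset_iff)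
qed (simp add: simple_object_def)

lemma subobject_full:
  assumes "is_fusion_subcategory C D" "X \<in> D" "Y \<in> D"
  shows "subobject (full_subcategory C D) X Y \<longleftrightarrow> subobject C X Y"
  using assms by (simp add: subobject_def mono_arrow_full)

lemma is_fusion_subcategory_full:
  assumes D: "is_fusion_subcategory C D"
  shows "is_fusion_subcategory (full_subcategory C D) E \<longleftrightarrow> is_fusion_subcategory C E \<and> E \<subseteq> D"
proof
  note D' = is_fusion_subcategoryD[OF D]
  assume E: "is_fusion_subcategory (full_subcategory C D) E"
  note E' =
      is_fusion_subcategoryD[OF E, unfolded full_subcategory_sel full_subcategory_monoidal_sel
      full_subcategory_Dual is_direct_sum_full]
  have "is_fusion_subcategory C E"
    unfolding is_fusion_subcategory_def
  proof (intro conjI ballI allI impI)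
    show "E \<subseteq> Obj C"
      using E'(1) D'(1) by blast
    show "P \<in> E" if "P \<in> Obj C" "set Xs \<subseteq> E \<and> is_direct_sum C Xs P" for Xs P
      using that E'(1) E'(5)[of P Xs] D'(5)[of P Xs] by blast
    show "Y \<in> E" if "X \<in> E" "Y \<in> Obj C" "subobject C Y X" for X Y
      using that E'(1) E'(6)[of X Y] D'(6)[of X Y] subobject_full[OF D, of Y X] by blast
  qed (simp_all add: E')
  then show "is_fusion_subcategory C E \<and> E \<subseteq> D"
    using E'(1) by simp
next
  note D' = is_fusion_subcategoryD[OF D]
  assume "is_fusion_subcategory C E \<and> E \<subseteq> D"
  then have E: "is_fusion_subcategory C E" and ED: "E \<subseteq> D"
    by simp_all
  note E' = is_fusion_subcategoryD[OF E]
  show "is_fusion_subcategory (full_subcategory C D) E"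
    unfolding is_fusion_subcategory_def full_subcategory_sel full_subcategory_monoidal_sel
      full_subcategory_Dual is_direct_sum_full
  proof (intro conjI ballI allI impI)
    show "P \<in> E" if "P \<in> D" "set Xs \<subseteq> E \<and> is_direct_sum C Xs P" for Xs P
      using that E'(5)[of P Xs] D'(1) by blast
    show "Y \<in> E" if "X \<in> E" "Y \<in> D" "subobject (full_subcategory C D) Y X" for X Y
      using that ED E'(6)[of X Y] D'(1) subobject_full[OF D, of Y X] by blast
  qed (simp_all add: E' ED)
qed

definition adjoint_objects :: "'o set \<Rightarrow> 'o set" where
  "adjoint_objects D = Obj (adjoint_subcategory (full_subcategory C D))"

lemma adjoint_subcategory_full:
  "adjoint_subcategory (full_subcategory C D) = full_subcategory C (adjoint_objects D)"
  by (simp add: adjoint_objects_def adjoint_subcategory_def generated_subcategory_def)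

text \<open>
  The iterated definition of the upper central series refers to simple objects and fusion
  subcategories inside the previous term; here all of them are expressed in \<open>C\<close>.
\<close>

lemma adjoint_objects_eq:
  assumes D: "is_fusion_subcategory C D"
  shows "adjoint_objects D =
    \<Inter>{E. is_fusion_subcategory C E \<and> E \<subseteq> D \<and> (\<forall>X\<in>D. simple_object C X \<longrightarrow> X \<otimes>\<^sub>o Dual C X \<in> E)}"
proof -
  let ?A = "{Z \<in> D. \<exists>X. simple_object (full_subcategory C D) X \<and> subobject
      (full_subcategory C D) Z (X \<otimes>\<^sub>o Dual C X)}"
  note D' = is_fusion_subcategoryD[OF D]
  have XX: "X \<otimes>\<^sub>o Dual C X \<in> D" if "X \<in> D" for X
    using that D' by simp
  have A: "Z \<in> ?A \<longleftrightarrow> Z \<in> D \<and> (\<exists>X\<in>D. simple_object C X \<and> subobject C Z (X \<otimes>\<^sub>o Dual C X))" for Z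
    using subobject_full[OF D, of Z] XX by (auto simp: simple_object_full[OF D])
  have refl: "subobject C Z Z" if "Z \<in> D" for Z
    using that D'(1) by (intro subobject_split[where p = "Id C Z" and i = "Id C Z"])
        (auto simp: Id_in_Hom Id_Comp[of Z Z])
  have "?A \<subseteq> E \<longleftrightarrow> (\<forall>X\<in>D. simple_object C X \<longrightarrow> X \<otimes>\<^sub>o Dual C X \<in> E)"
    if E: "is_fusion_subcategory C E" for E
  proof
    assume "?A \<subseteq> E"
    then show "\<forall>X\<in>D. simple_object C X \<longrightarrow> X \<otimes>\<^sub>o Dual C X \<in> E"
      using A XX refl by blast
  next
    assume *: "\<forall>X\<in>D. simple_object C X \<longrightarrow> X \<otimes>\<^sub>o Dual C X \<in> E"
    show "?A \<subseteq> E"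
      using A * is_fusion_subcategoryD(6)[OF E] D'(1) by blast
  qed
  then show ?thesis
    unfolding adjoint_objects_def adjoint_subcategory_def generated_subcategory_def
    by (auto simp: is_fusion_subcategory_full[OF D])
qed

lemma adjoint_objects_fusion:
  assumes D: "is_fusion_subcategory C D"
  shows "is_fusion_subcategory C (adjoint_objects D)" and "adjoint_objects D \<subseteq> D"
    and "\<lbrakk>X \<in> D; simple_object C X\<rbrakk> \<Longrightarrow> X \<otimes>\<^sub>o Dual C X \<in> adjoint_objects D"
proof -
  have "D \<in>
      {E. is_fusion_subcategory C E \<and> E \<subseteq> D \<and> (\<forall>X\<in>D. simple_object C X \<longrightarrow> X \<otimes>\<^sub>o Dual C X \<in> E)}"
    using D by (auto simp: is_fusion_subcategory_def)
  then show "is_fusion_subcategory C (adjoint_objects D)" "adjoint_objects D \<subseteq> D"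
    unfolding adjoint_objects_eq[OF D] by (blast intro: is_fusion_subcategory_Inter)+
  show "X \<otimes>\<^sub>o Dual C X \<in> adjoint_objects D" if "X \<in> D" "simple_object C X"
    using that unfolding adjoint_objects_eq[OF D] by blast
qed

lemma adjoint_objects_least:
  assumes D: "is_fusion_subcategory C D" and E: "is_fusion_subcategory C E"
    and DE: "\<And>X. \<lbrakk>X \<in> D; simple_object C X\<rbrakk> \<Longrightarrow> X \<otimes>\<^sub>o Dual C X \<in> E"
  shows "adjoint_objects D \<subseteq> E"
proof -
  have "is_fusion_subcategory C (D \<inter> E)"
    using is_fusion_subcategory_Inter[of "{D, E}" C] D E by auto
  moreover have "X \<otimes>\<^sub>o Dual C X \<in> D \<inter> E" if "X \<in> D" "simple_object C X" for X
    using that D DE by (auto simp: is_fusion_subcategory_def)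
  ultimately show ?thesis
    unfolding adjoint_objects_eq[OF D] by blast
qed

lemma upper_central_full:
  "upper_central C n = full_subcategory C ((adjoint_objects ^^ n) (Obj C)) \<and>
    is_fusion_subcategory C ((adjoint_objects ^^ n) (Obj C))"
proof (induction n)
  case 0
  show ?case
    by (simp add: upper_central_def is_fusion_subcategory_Obj)
next
  case (Suc n)
  then show ?case
    by (simp add: upper_central_def adjoint_subcategory_full adjoint_objects_fusion(1))
qed

end


section \<open>The upper central series of a braided fusion category\<close>

context fusion_category
begin

text \<open>
  If the evaluation vanished, so would the unit constraint of \<open>Y\<close>, by the zigzag identity.
\<close>

lemma Ev_nonzero:
  assumes Y: "Y \<in> Obj C" "Id C Y \<noteq> 0"
  shows "Ev C Y \<noteq> 0"
proof
  note [simp] = Y(1) Dual_in_Obj Unit_in_Obj TObj_in_Obj Id_in_Hom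
  let ?Y = "Dual C Y"
  assume ev: "Ev C Y = 0"
  have coev: "Coev C Y \<in> Hom C (Unit C) (Y \<otimes>\<^sub>o ?Y)"
    and zigzag:
        "RUnit C Y \<cdot> (Id C Y \<otimes>\<^sub>a Ev C Y) \<cdot> Assoc C Y ?Y Y \<cdot> (Coev C Y \<otimes>\<^sub>a Id C Y) = LUnit C Y"
    using Dual_is_left_dual[of Y] by (simp_all add: is_duality_def)
  have "arr (assoc Y ?Y Y)" "arr (runit Y)" "arr (lunit Y)"
    by simp_all
  then have a: "Assoc C Y ?Y Y \<in> Hom C ((Y \<otimes>\<^sub>o ?Y) \<otimes>\<^sub>o Y) (Y \<otimes>\<^sub>o ?Y \<otimes>\<^sub>o Y)"
    and r: "RUnit C Y \<in> Hom C (Y \<otimes>\<^sub>o Unit C) Y" and l: "LUnit C Y \<in> Hom C (Unit C \<otimes>\<^sub>o Y) Y"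
    by (simp_all add: assoc_def runit_def lunit_def)
  have "Coev C Y \<otimes>\<^sub>a Id C Y \<in> Hom C (Unit C \<otimes>\<^sub>o Y) ((Y \<otimes>\<^sub>o ?Y) \<otimes>\<^sub>o Y)"
    using coev by (intro TArr_in_Hom) simp_all
  then have "Assoc C Y ?Y Y \<cdot> (Coev C Y \<otimes>\<^sub>a Id C Y) \<in> Hom C (Unit C \<otimes>\<^sub>o Y) (Y \<otimes>\<^sub>o ?Y \<otimes>\<^sub>o Y)"
    by (intro Comp_in_Hom[OF _ _ _ _ a]) simp_all
  then have "0 \<cdot> Assoc C Y ?Y Y \<cdot> (Coev C Y \<otimes>\<^sub>a Id C Y) = 0"
    by (intro zero_Comp[of "Unit C \<otimes>\<^sub>o Y" "Y \<otimes>\<^sub>o ?Y \<otimes>\<^sub>o Y" "Y \<otimes>\<^sub>o Unit C"]) simp_all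
  moreover have "Id C Y \<otimes>\<^sub>a Ev C Y = 0"
    using TArr_add_right[of Y Y "?Y \<otimes>\<^sub>o Y" "Unit C" "Id C Y" 0 0] unfolding ev by simp
  ultimately have "LUnit C Y = 0"
    using zigzag r by (simp add: Comp_zero[of "Unit C \<otimes>\<^sub>o Y" "Y \<otimes>\<^sub>o Unit C" Y])
  moreover obtain l' where "l' \<in> Hom C Y (Unit C \<otimes>\<^sub>o Y)" "LUnit C Y \<cdot> l' = Id C Y"
    using LUnit_iso[of Y] unfolding iso_arrow_def mutually_inverse_def by auto
  ultimately show False
    using Y zero_Comp[of Y "Unit C \<otimes>\<^sub>o Y" Y l'] by simp
qed

lemma summands_mem:
  assumes E: "is_fusion_subcategory C E" and "Y \<in> E" and Ys: "\<And>S. S \<in> set Ys \<Longrightarrow> S \<in> Obj C"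
    and sum: "is_direct_sum C Ys Y"
  shows "set Ys \<subseteq> E"
proof
  fix S
  assume S: "S \<in> set Ys"
  note E' = is_fusion_subcategoryD[OF E]
  obtain i where i: "i < length Ys" "S = Ys ! i"
    using S by (auto simp: in_set_conv_nth)
  then obtain \<iota> \<pi> where "\<iota> \<in> Hom C S Y" "\<pi> \<in> Hom C Y S" "\<pi> \<cdot> \<iota> = Id C S"
    using sum unfolding is_direct_sum_def by metis
  then have "subobject C S Y"
    using subobject_split[of Y S \<iota> \<pi>] S Ys E'(1) \<open>Y \<in> E\<close> by blast
  then show "S \<in> E"
    using E'(6) \<open>Y \<in> E\<close> S Ys by blast
qed

end

context braided_fusion_category
begin

text \<open>
  The unit object is simple, so it is a direct summand of \<open>Y\<^sup>* \<otimes> Y\<close>.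
\<close>

lemma ev_split:
  assumes "Y \<in> Obj C" "Id C Y \<noteq> 0"
  shows "\<exists>s. arr s \<and> Dom s = Unit C \<and> Cod s = Dual C Y \<otimes>\<^sub>o Y \<and> ev Y \<circ>\<^sub>t s = ident (Unit C)"
proof -
  have "Ev C Y \<in> Hom C (Dual C Y \<otimes>\<^sub>o Y) (Unit C)"
    using arr_ev[OF assms(1)] by (simp add: ev_def)
  then obtain s where "s \<in> Hom C (Unit C) (Dual C Y \<otimes>\<^sub>o Y)" "Ev C Y \<cdot> s = Id C (Unit C)"
    using split_epi_onto_simple[OF _ Unit_simple, of "Dual C Y \<otimes>\<^sub>o Y" "Ev C Y"] Ev_nonzero assms
        by auto
  then show ?thesis
    using assms(1)
    by (intro exI[of _ "Arrow (Unit C) s (Dual C Y \<otimes>\<^sub>o Y)"])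
        (simp add: ev_def compose_def ident_def)
qed

lemma centralizer_sym:
  assumes "D \<subseteq> centralizer E" "E \<subseteq> Obj C"
  shows "E \<subseteq> centralizer D"
  using assms monodromy_sym unfolding centralizer_monodromy by blast

text \<open>
  \<open>D\<^sub>a\<^sub>d\<close> is generated by the objects \<open>X \<otimes> X\<^sup>*\<close> with \<open>X\<close> simple in \<open>D\<close>, and an object of \<open>E\<close> is a
  direct sum of simple objects of \<open>E\<close>. For two simple objects the claim is \<open>monodromy_adjoint\<close>,
  as \<open>X\<close> centralizes \<open>S \<otimes> S\<^sup>*\<close> for \<open>S\<close> simple in \<open>E\<close>; both reductions work because centralizers
  are fusion subcategories.
\<close>

lemma centralizer_adjoint_objects:
  assumes D: "is_fusion_subcategory C D" and E: "is_fusion_subcategory C E"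
    and DE: "D \<subseteq> centralizer (adjoint_objects E)"
  shows "adjoint_objects D \<subseteq> centralizer E"
proof (rule adjoint_objects_least[OF D])
  have EC: "E \<subseteq> Obj C"
    by (rule is_fusion_subcategoryD(1)[OF E])
  show "is_fusion_subcategory C (centralizer E)"
    by (rule centralizer_fusion[OF EC])
  fix X
  assume "X \<in> D" and X: "simple_object C X"
  then have [simp]: "X \<in> Obj C"
    by (simp add: simple_object_def)
  let ?XX = "X \<otimes>\<^sub>o Dual C X"
  have simples: "S \<in> centralizer {?XX}" if "S \<in> E" and S: "simple_object C S" for S
  proof -
    have [simp]: "S \<in> Obj C"
      using S by (simp add: simple_object_def)
    obtain s where "arr s" "Dom s = Unit C" "Cod s = Dual C S \<otimes>\<^sub>o S" "ev S \<circ>\<^sub>t s = ident (Unit C)"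
      using ev_split[of S] simple_object_Id[OF S] by auto
    moreover have "S \<otimes>\<^sub>o Dual C S \<in> adjoint_objects E"
      using adjoint_objects_fusion(3)[OF E] that by blast
    then have "monodromy X (S \<otimes>\<^sub>o Dual C S) = ident (X \<otimes>\<^sub>o S \<otimes>\<^sub>o Dual C S)"
      using DE \<open>X \<in> D\<close> by (auto simp: centralizer_monodromy)
    ultimately have "monodromy ?XX S = ident (?XX \<otimes>\<^sub>o S)"
      by (intro monodromy_adjoint schur_scalar X) simp_all
    then show ?thesis
      using monodromy_sym[of ?XX S] by (simp add: centralizer_monodromy)
  qed
  have "E \<subseteq> centralizer {?XX}"
  proof
    fix Y
    assume Y: "Y \<in> E"
    then obtain Ys where Ys: "\<forall>S\<in>set Ys. simple_object C S" "is_direct_sum C Ys Y"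
      using semisimple EC by blast
    then have "set Ys \<subseteq> E"
      using summands_mem[OF E Y] by (simp add: simple_object_def)
    then have "set Ys \<subseteq> centralizer {?XX}"
      using simples Ys by blast
    then show "Y \<in> centralizer {?XX}"
      using is_fusion_subcategoryD(5)[OF centralizer_fusion[of "{?XX}"], of Y Ys] Ys Y EC by auto
  qed
  then show "?XX \<in> centralizer E"
    using centralizer_sym[of E "{?XX}"] by simp
qed

text \<open>
  Each application of \<open>centralizer_adjoint_objects\<close> moves one adjoint from the right to the left.
\<close>

lemma upper_central_centralizes:
  defines "Z \<equiv> \<lambda>n. (adjoint_objects ^^ n) (Obj C)"
  assumes "Obj C \<subseteq> centralizer (Z c)" "m \<le> c"
  shows "Z m \<subseteq> centralizer (Z (c - m))"
  using assms(3)
proof (induction m)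
  case 0
  show ?case
    using assms(2) by (simp add: Z_def)
next
  case (Suc m)
  have fusion: "is_fusion_subcategory C (Z k)" for k
    using upper_central_full by (simp add: Z_def)
  have "Z (c - m) = adjoint_objects (Z (c - Suc m))"
    using Suc.prems by
        (simp add: Z_def Suc_diff_Suc flip: funpow.simps(2)[THEN fun_cong, simplified comp_apply])
  then have "adjoint_objects (Z m) \<subseteq> centralizer (Z (c - Suc m))"
    using Suc by (intro centralizer_adjoint_objects fusion) simp
  then show ?case
    by (simp add: Z_def)
qed

lemma upper_central_symmetric:
  assumes vec: "upper_central C c = Vec_subcategory C" and n: "c \<le> 2 * n"
  shows "symmetric_braiding (upper_central C n)"
proof -
  let ?Z = "\<lambda>n. (adjoint_objects ^^ n) (Obj C)"
  have Z: "upper_central C k = full_subcategory C (?Z k)"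
    and fusion: "is_fusion_subcategory C (?Z k)" for k
    using upper_central_full by auto
  have dec: "?Z k \<subseteq> ?Z j" if "j \<le> k" for j k
    using that
  proof (induction rule: dec_induct)
    case (step k)
    then show ?case
      using adjoint_objects_fusion(2)[OF fusion, of k] by auto
  qed simp
  have "?Z c = Obj (Vec_subcategory C)"
    using Z[of c] by (simp flip: vec)
  also have "\<dots> \<subseteq> centralizer (Obj C)"
    using centralizer_fusion[of "Obj C"]
    by (auto simp: Vec_subcategory_def generated_subcategory_def is_fusion_subcategoryD(2))
  finally have "Obj C \<subseteq> centralizer (?Z c)"
    using is_fusion_subcategoryD(1)[OF fusion, of c] centralizer_sym[of "?Z c" "Obj C"] by blast
  \<comment> \<open>For \<open>n > c\<close> the \<open>c\<close>-th term takes the place of the \<open>n\<close>-th one, which it contains.\<close>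
  then have "?Z (min n c) \<subseteq> centralizer (?Z (c - min n c))"
    by (rule upper_central_centralizes) simp
  moreover have "?Z n \<subseteq> ?Z (min n c)" "?Z n \<subseteq> ?Z (c - min n c)"
    using n by (intro dec; simp)+
  ultimately have "double_braiding C X Y = Id C (X \<otimes>\<^sub>o Y)" if "X \<in> ?Z n" "Y \<in> ?Z n" for X Y
    using that unfolding centralizer_def by blast
  then show ?thesis
    by (simp add: Z symmetric_braiding_def full_subcategory_def double_braiding_def)
qed

end

theorem corollary6p10:
  fixes C :: "('o, 'm::ab_group_add, 'k::{alg_closed_field, field_char_0}) ribbon_data"
    and c n :: nat
  assumes "modular_category C"
    and "nilpotent_category C"
    and "nilpotency_class C = c"
    and "real n \<ge> real c / 2"
  shows "symmetric_braiding (upper_central C n)"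
proof -
  interpret modular_category C
    by (rule assms)
  have "upper_central C (nilpotency_class C) = Vec_subcategory C"
    using assms(2) unfolding nilpotency_class_def nilpotent_category_def by (rule LeastI_ex)
  moreover have "c \<le> 2 * n"
    using assms(4) by linarith
  ultimately show ?thesis
    using upper_central_symmetric assms(3) by simp
qed

end
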